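(* Let $\sigma:\Sigma\to\Sigma$ be a transitive one-sided subshift of finite type and let $A:\hat\Sigma\to\mathbb R$ be a $\theta$-Hölder potential. Then there exists a bijective correspondence, isometric with respect to the supremum norms, between the set of calibrated sub-actions for $A$ and the set of functions $f\in C^0(\Omega(A))$ satisfying $f(\bar{\mathbf x})-f(\mathbf x)\le S_A(\mathbf x,\bar{\mathbf x})$ for all $\mathbf x,\bar{\mathbf x}\in\Omega(A)$.
   Context: Let $\mathbf M$ be an $r\times r$ matrix with entries in $\{0,1\}$. The one-sided subshift of finite type is $\Sigma=\{\mathbf x=(x_0,x_1,\ldots)\in\{1,\ldots,r\}^{\mathbb N}:\mathbf M(x_j,x_{j+1})=1\ \forall j\ge 0\}$ (nonempty), with the left shift $\sigma(x_0,x_1,\ldots)=(x_1,x_2,\ldots)$. Fix $\lambda\in(0,1)$; $\Sigma$ has the metric $d(\mathbf x,\bar{\mathbf x})=\lambda^{k}$, $k=\min\{j:x_j\ne\bar x_j\}$ (and $d(\mathbf x,\mathbf x)=0$). The dual space is $\Sigma^*=\{\mathbf y=(\ldots,y_1,y_0)\in\{1,\ldots,r\}^{\mathbb N}:\mathbf M(y_{j+1},y_j)=1\ \forall j\ge0\}$, with the analogous metric. Let $\hat\Sigma=\{(\mathbf y,\mathbf x)\in\Sigma^*\times\Sigma:\mathbf M(y_0,x_0)=1\}$, with the maximum metric induced from the product. Define $\tau:\hat\Sigma\to\Sigma$ by $\tau(\mathbf y,\mathbf x)=\tau_{\mathbf y}(\mathbf x)=(y_0,x_0,x_1,\ldots)$,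 and for $\mathbf x\in\Sigma$ let $\Sigma^*_{\mathbf x}=\{\mathbf y\in\Sigma^*:(\mathbf y,\mathbf x)\in\hat\Sigma\}$. $C^0(\cdot)$ denotes real-valued continuous functions (with supremum norm $\|\cdot\|_0$) and $C^\theta(\cdot)$ (with $\theta>0$) the $\theta$-Hölder ones. Transitive means topologically transitive: for all nonempty open $D,E\subset\Sigma$ there is $k\ge1$ with $\sigma^k(D)\cap E\neq\emptyset$. The set $\mathcal M_0$ of holonomic probabilities is the set of Borel probability measures $\hat\mu$ on $\hat\Sigma$ such that $\int f(\tau_{\mathbf y}(\mathbf x))\,d\hat\mu(\mathbf y,\mathbf x)=\int f(\mathbf x)\,d\hat\mu(\mathbf y,\mathbf x)$ for all $f\in C^0(\Sigma)$. For $A\in C^0(\hat\Sigma)$, $\beta_A=\max_{\hat\mu\in\mathcal M_0}\int_{\hat\Sigma}A\,d\hat\mu$. A calibrated sub-action for $A$ is $u\in C^0(\Sigma)$ with $u(\mathbf x)=\min_{\mathbf y\in\Sigma^*_{\mathbf x}}[u(\tau_{\mathbf y}(\mathbf x))-A(\mathbf y,\mathbf x)+\beta_A]$ for all $\mathbf x\in\Sigma$. For $\epsilon>0$ and $\mathbf x,\bar{\mathbf x}\in\Sigma$, $\mathcal P(\mathbf x,\bar{\mathbf x},\epsilon)$ is the set of finite sequences (paths) $(\mathbf y^0,\mathbf x^0),\ldots,(\mathbf y^{k-1},\mathbf x^{k-1})\in\hat\Sigma$, $k\ge1$, with $\mathbf x^0=\bar{\mathbf x}$, $\mathbf x^{j+1}=\tau_{\mathbf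 y^j}(\mathbf x^j)$ for $0\le j<k-1$, and $d(\tau_{\mathbf y^{k-1}}(\mathbf x^{k-1}),\mathbf x)<\epsilon$. The set of non-wandering points $\Omega(A)$ consists of those $\mathbf x\in\Sigma$ such that for every $\epsilon>0$ there is a path in $\mathcal P(\mathbf x,\mathbf x,\epsilon)$ with $|\sum_{j=0}^{k-1}(A-\beta_A)(\mathbf y^j,\mathbf x^j)|<\epsilon$. The Mañé potential $S_A:\Sigma\times\Sigma\to\mathbb R\cup\{\pm\infty\}$ is $S_A(\mathbf x,\bar{\mathbf x})=\lim_{\epsilon\to0}S_A^\epsilon(\mathbf x,\bar{\mathbf x})$, where $S_A^\epsilon(\mathbf x,\bar{\mathbf x})=\inf\bigl[-\sum_{j=0}^{k-1}(A-\beta_A)(\mathbf y^j,\mathbf x^j)\bigr]$, the infimum being over all paths in $\mathcal P(\mathbf x,\bar{\mathbf x},\epsilon)$ ($\inf\emptyset=+\infty$). *)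

theory Defs
  imports "HOL-Analysis.Analysis" "HOL-Probability.Probability"
begin

text \<open>
  A point of either one-sided space is a function \<^typ>\<open>nat \<Rightarrow> nat\<close>. For a point
  \<open>y = (\<dots>, y\<^sub>1, y\<^sub>0)\<close> of the dual space, \<open>y j\<close> is \<open>y\<^sub>j\<close>, so the sequence is listed from
  right to left. Points of the extension are pairs \<open>(y, x)\<close>. Only the entries of \<open>M\<close> with
  both indices in \<open>{1..r}\<close> matter.
\<close>

definition sft :: "nat \<Rightarrow> (nat \<Rightarrow> nat \<Rightarrow> nat) \<Rightarrow> (nat \<Rightarrow> nat) set"
  where "sft r M = {x. (\<forall>j. x j \<in> {1..r}) \<and> (\<forall>j. M (x j) (x (Suc j)) = 1)}"

definition sft_dual :: "nat \<Rightarrow> (nat \<Rightarrow> nat \<Rightarrow> nat) \<Rightarrow> (nat \<Rightarrow> nat) set"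
  where "sft_dual r M = {y. (\<forall>j. y j \<in> {1..r}) \<and> (\<forall>j. M (y (Suc j)) (y j) = 1)}"

definition sft_ext :: "nat \<Rightarrow> (nat \<Rightarrow> nat \<Rightarrow> nat) \<Rightarrow> ((nat \<Rightarrow> nat) \<times> (nat \<Rightarrow> nat)) set"
  where "sft_ext r M = {(y, x). y \<in> sft_dual r M \<and> x \<in> sft r M \<and> M (y 0) (x 0) = 1}"

definition sft_fiber :: "nat \<Rightarrow> (nat \<Rightarrow> nat \<Rightarrow> nat) \<Rightarrow> (nat \<Rightarrow> nat) \<Rightarrow> (nat \<Rightarrow> nat) set"
  where "sft_fiber r M x = {y \<in> sft_dual r M. (y, x) \<in> sft_ext r M}"

definition left_shift :: "(nat \<Rightarrow> nat) \<Rightarrow> nat \<Rightarrow> nat"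
  where "left_shift x = (\<lambda>j. x (Suc j))"

definition tau :: "(nat \<Rightarrow> nat) \<times> (nat \<Rightarrow> nat) \<Rightarrow> nat \<Rightarrow> nat"
  where "tau = (\<lambda>(y, x). case_nat (y 0) x)"


definition seq_dist :: "real \<Rightarrow> (nat \<Rightarrow> nat) \<Rightarrow> (nat \<Rightarrow> nat) \<Rightarrow> real"
  where "seq_dist lam x x' = (if x = x' then 0 else lam ^ (LEAST j. x j \<noteq> x' j))"

definition ext_dist ::
    "real \<Rightarrow> (nat \<Rightarrow> nat) \<times> (nat \<Rightarrow> nat) \<Rightarrow> (nat \<Rightarrow> nat) \<times> (nat \<Rightarrow> nat) \<Rightarrow> real"
  where "ext_dist lam p q =
    max (seq_dist lam (fst p) (fst q)) (seq_dist lam (snd p) (snd q))"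

lemma Metric_space_seq_dist:
  assumes "0 < lam" "lam < 1"
  shows "Metric_space X (seq_dist lam)"
proof
  fix x y z :: "nat \<Rightarrow> nat"
  show "0 \<le> seq_dist lam x y"
    using assms by (simp add: seq_dist_def)
  show "seq_dist lam x y = seq_dist lam y x"
    by (simp add: seq_dist_def eq_commute)
  show "seq_dist lam x y = 0 \<longleftrightarrow> x = y"
    using assms by (simp add: seq_dist_def)
  show "seq_dist lam x z \<le> seq_dist lam x y + seq_dist lam y z"
  proof (cases "x = y \<or> y = z \<or> x = z")
    case True
    then show ?thesis
      using assms by (auto simp: seq_dist_def)
  next
    case False
    define a where "a = (LEAST j. x j \<noteq> y j)"
    define b where "b = (LEAST j. y j \<noteq> z j)"
    define c where "c = (LEAST j. x j \<noteq> z j)"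
    have "\<exists>j. x j \<noteq> z j"
      using False by (auto simp: fun_eq_iff)
    then have "x c \<noteq> z c"
      unfolding c_def by (rule LeastI_ex)
    then have "x c \<noteq> y c \<or> y c \<noteq> z c"
      by auto
    moreover have "a \<le> c" if "x c \<noteq> y c"
      unfolding a_def using that by (rule Least_le)
    moreover have "b \<le> c" if "y c \<noteq> z c"
      unfolding b_def using that by (rule Least_le)
    ultimately have "a \<le> c \<or> b \<le> c"
      by blast
    then have "lam ^ c \<le> lam ^ a \<or> lam ^ c \<le> lam ^ b"
      using power_decreasing[of a c lam] power_decreasing[of b c lam] assms by auto
    moreover have "0 < lam ^ a" "0 < lam ^ b"
      using assms by auto
    ultimately have "lam ^ c \<le> lam ^ a + lam ^ b"
      by linarith
    then show ?thesis
      using False by (simp add: seq_dist_def a_def b_def c_def)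
  qed
qed

lemma Metric_space_ext_dist:
  assumes "0 < lam" "lam < 1"
  shows "Metric_space X (ext_dist lam)"
proof -
  have S: "Metric_space UNIV (seq_dist lam)"
    using assms by (rule Metric_space_seq_dist)
  note nonneg = Metric_space.nonneg[OF S]
    and zero = Metric_space.zero[OF S UNIV_I UNIV_I]
    and commute = Metric_space.commute[OF S]
    and triangle = Metric_space.triangle[OF S UNIV_I UNIV_I UNIV_I]
  show ?thesis
  proof
    fix p q s :: "(nat \<Rightarrow> nat) \<times> (nat \<Rightarrow> nat)"
    show "0 \<le> ext_dist lam p q"
      unfolding ext_dist_def using nonneg by (rule max.coboundedI1)
    show "ext_dist lam p q = ext_dist lam q p"
      unfolding ext_dist_def
      by (simp only: commute[of "fst p" "fst q"] commute[of "snd p" "snd q"])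
    have "max a b = 0 \<longleftrightarrow> a = 0 \<and> b = 0" if "0 \<le> a" "0 \<le> b" for a b :: real
      using that by (auto simp: max_def)
    then show "ext_dist lam p q = 0 \<longleftrightarrow> p = q"
      by (simp only: ext_dist_def prod_eq_iff nonneg zero)
    have *: "max a b \<le> max a1 b1 + max a2 b2" if "a \<le> a1 + a2" "b \<le> b1 + b2"
      for a b a1 a2 b1 b2 :: real
      using that by (auto simp: max_def)
    show "ext_dist lam p s \<le> ext_dist lam p q + ext_dist lam q s"
      unfolding ext_dist_def by (intro * triangle)
  qed
qed

abbreviation seq_top :: "real \<Rightarrow> (nat \<Rightarrow> nat) set \<Rightarrow> (nat \<Rightarrow> nat) topology"
  where "seq_top lam X \<equiv> Metric_space.mtopology X (seq_dist lam)"

abbreviation ext_top ::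
    "real \<Rightarrow> ((nat \<Rightarrow> nat) \<times> (nat \<Rightarrow> nat)) set \<Rightarrow> ((nat \<Rightarrow> nat) \<times> (nat \<Rightarrow> nat)) topology"
  where "ext_top lam X \<equiv> Metric_space.mtopology X (ext_dist lam)"


text \<open>
  Functions on a space are represented by their extensional representatives, so that two
  of them are equal as soon as they agree on the space.
\<close>

definition cont_funs :: "'a topology \<Rightarrow> ('a \<Rightarrow> real) set"
  where "cont_funs X = {f \<in> extensional (topspace X). continuous_map X euclideanreal f}"

definition sup_norm :: "'a set \<Rightarrow> ('a \<Rightarrow> real) \<Rightarrow> real"
  where "sup_norm X f = (SUP x\<in>X. \<bar>f x\<bar>)"

definition holder_fun :: "real \<Rightarrow> 'a set \<Rightarrow> ('a \<Rightarrow> 'a \<Rightarrow> real) \<Rightarrow> ('a \<Rightarrow> real) \<Rightarrow> bool"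
  where "holder_fun \<theta> X d f \<longleftrightarrow> (\<exists>C. \<forall>p\<in>X. \<forall>q\<in>X. \<bar>f p - f q\<bar> \<le> C * d p q powr \<theta>)"

definition transitive_map :: "'a topology \<Rightarrow> ('a \<Rightarrow> 'a) \<Rightarrow> bool"
  where "transitive_map X T \<longleftrightarrow>
    (\<forall>D E. openin X D \<and> D \<noteq> {} \<and> openin X E \<and> E \<noteq> {} \<longrightarrow>
      (\<exists>k\<ge>1. (T ^^ k) ` D \<inter> E \<noteq> {}))"

definition borel_prob :: "'a topology \<Rightarrow> 'a measure set"
  where "borel_prob X =
    {\<mu>. prob_space \<mu> \<and> space \<mu> = topspace X \<and> sets \<mu> = sigma_sets (topspace X) {U. openin X U}}"

definition holonomic ::
    "real \<Rightarrow> nat \<Rightarrow> (nat \<Rightarrow> nat \<Rightarrow> nat) \<Rightarrow> ((nat \<Rightarrow> nat) \<times> (nat \<Rightarrow> nat)) measure set"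
  where "holonomic lam r M =
    {\<mu> \<in> borel_prob (ext_top lam (sft_ext r M)).
      \<forall>f \<in> cont_funs (seq_top lam (sft r M)).
        (\<integral>p. f (tau p) \<partial>\<mu>) = (\<integral>p. f (snd p) \<partial>\<mu>)}"

text \<open>
  For continuous \<open>A\<close> the supremum below is a maximum, because the holonomic probabilities
  form a nonempty weak* compact set.
\<close>

definition beta ::
    "real \<Rightarrow> nat \<Rightarrow> (nat \<Rightarrow> nat \<Rightarrow> nat) \<Rightarrow> ((nat \<Rightarrow> nat) \<times> (nat \<Rightarrow> nat) \<Rightarrow> real) \<Rightarrow> real"
  where "beta lam r M A = (SUP \<mu>\<in>holonomic lam r M. (\<integral>p. A p \<partial>\<mu>))"

definition is_minimum :: "real set \<Rightarrow> real \<Rightarrow> bool"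
  where "is_minimum V m \<longleftrightarrow> m \<in> V \<and> (\<forall>v\<in>V. m \<le> v)"

definition calibrated_subactions ::
    "real \<Rightarrow> nat \<Rightarrow> (nat \<Rightarrow> nat \<Rightarrow> nat) \<Rightarrow> ((nat \<Rightarrow> nat) \<times> (nat \<Rightarrow> nat) \<Rightarrow> real)
      \<Rightarrow> ((nat \<Rightarrow> nat) \<Rightarrow> real) set"
  where "calibrated_subactions lam r M A =
    {u \<in> cont_funs (seq_top lam (sft r M)). \<forall>x \<in> sft r M.
      is_minimum ((\<lambda>y. u (tau (y, x)) - A (y, x) + beta lam r M A) ` sft_fiber r M x) (u x)}"


definition paths ::
    "real \<Rightarrow> nat \<Rightarrow> (nat \<Rightarrow> nat \<Rightarrow> nat) \<Rightarrow> (nat \<Rightarrow> nat) \<Rightarrow> (nat \<Rightarrow> nat) \<Rightarrow> real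
      \<Rightarrow> ((nat \<Rightarrow> nat) \<times> (nat \<Rightarrow> nat)) list set"
  where "paths lam r M x x' \<epsilon> =
    {ps. ps \<noteq> [] \<and> set ps \<subseteq> sft_ext r M \<and> snd (hd ps) = x' \<and>
      (\<forall>j. Suc j < length ps \<longrightarrow> snd (ps ! Suc j) = tau (ps ! j)) \<and>
      seq_dist lam (tau (last ps)) x < \<epsilon>}"

definition path_sum ::
    "real \<Rightarrow> nat \<Rightarrow> (nat \<Rightarrow> nat \<Rightarrow> nat) \<Rightarrow> ((nat \<Rightarrow> nat) \<times> (nat \<Rightarrow> nat) \<Rightarrow> real)
      \<Rightarrow> ((nat \<Rightarrow> nat) \<times> (nat \<Rightarrow> nat)) list \<Rightarrow> real"
  where "path_sum lam r M A ps = (\<Sum>j<length ps. A (ps ! j) - beta lam r M A)"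

definition nonwandering ::
    "real \<Rightarrow> nat \<Rightarrow> (nat \<Rightarrow> nat \<Rightarrow> nat) \<Rightarrow> ((nat \<Rightarrow> nat) \<times> (nat \<Rightarrow> nat) \<Rightarrow> real)
      \<Rightarrow> (nat \<Rightarrow> nat) set"
  where "nonwandering lam r M A =
    {x \<in> sft r M. \<forall>\<epsilon>>0. \<exists>ps \<in> paths lam r M x x \<epsilon>. \<bar>path_sum lam r M A ps\<bar> < \<epsilon>}"

definition mane_eps ::
    "real \<Rightarrow> nat \<Rightarrow> (nat \<Rightarrow> nat \<Rightarrow> nat) \<Rightarrow> ((nat \<Rightarrow> nat) \<times> (nat \<Rightarrow> nat) \<Rightarrow> real)
      \<Rightarrow> real \<Rightarrow> (nat \<Rightarrow> nat) \<Rightarrow> (nat \<Rightarrow> nat) \<Rightarrow> ereal"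
  where "mane_eps lam r M A \<epsilon> x x' =
    (INF ps \<in> paths lam r M x x' \<epsilon>. ereal (- path_sum lam r M A ps))"

text \<open>The limit exists because \<^const>\<open>mane_eps\<close> is antitone in \<open>\<epsilon>\<close>.\<close>

definition mane ::
    "real \<Rightarrow> nat \<Rightarrow> (nat \<Rightarrow> nat \<Rightarrow> nat) \<Rightarrow> ((nat \<Rightarrow> nat) \<times> (nat \<Rightarrow> nat) \<Rightarrow> real)
      \<Rightarrow> (nat \<Rightarrow> nat) \<Rightarrow> (nat \<Rightarrow> nat) \<Rightarrow> ereal"
  where "mane lam r M A x x' = Lim (at_right 0) (\<lambda>\<epsilon>. mane_eps lam r M A \<epsilon> x x')"

definition admissible_funs ::
    "real \<Rightarrow> nat \<Rightarrow> (nat \<Rightarrow> nat \<Rightarrow> nat) \<Rightarrow> ((nat \<Rightarrow> nat) \<times> (nat \<Rightarrow> nat) \<Rightarrow> real)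
      \<Rightarrow> ((nat \<Rightarrow> nat) \<Rightarrow> real) set"
  where "admissible_funs lam r M A =
    {f \<in> cont_funs (seq_top lam (nonwandering lam r M A)).
      \<forall>x \<in> nonwandering lam r M A. \<forall>x' \<in> nonwandering lam r M A.
        ereal (f x' - f x) \<le> mane lam r M A x x'}"

end

theory Submission
  imports Defs
begin

text \<open>
  The correspondence is restriction to the non-wandering set \<open>\<Omega>\<close>.

  The point \<open>y\<close> of a pair \<open>(y, x)\<close> enters the dynamics only through its symbol \<open>y 0\<close>, so it can
  be optimised away. Put \<open>a z = max A (y, \<sigma> z)\<close>, the maximum being over the \<open>y\<close> with
  \<open>y 0 = z 0\<close>, and \<open>b = a - \<beta>\<close>, where \<open>\<sigma>\<close> is the shift and \<open>\<beta> = \<beta>\<^sub>A\<close>. A path is then the same as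
  a point \<open>z\<close> with \<open>\<sigma>\<^sup>k z\<close> the starting point, its largest possible weight is the Birkhoff sum
  \<open>S k z\<close> of \<open>b\<close>, and calibrated sub-actions are the continuous fixed points of the Lax-Oleinik
  operator \<open>T w x = min {w z - b z | \<sigma> z = x}\<close>. The minimum is over a finite set, so \<open>T\<close> commutes
  with increasing limits; moreover \<open>T\<close> preserves every Lipschitz condition with a large enough
  constant in the metric \<open>\<rho>\<^sup>n\<close>, \<open>\<rho> = lam\<^sup>\<theta>\<close>, \<open>n\<close> the length of the common prefix.

  \<^emph>\<open>Boundedness.\<close> The iterates \<open>T\<^sup>n 0\<close> are uniformly bounded. From below: any orbit segment can be
  closed to a periodic orbit at bounded cost (\<open>closing\<close>), and a periodic orbit carries a holonomic
  probability (\<open>periodic_holonomic\<close>), whose integral is at most \<open>\<beta>\<close>. From above: integrating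
  \<open>A - \<beta> \<le> T\<^sup>n 0 \<circ> \<tau> - T\<^sup>n\<^sup>+\<^sup>1 0 \<circ> snd\<close> against a holonomic probability telescopes
  (\<open>holonomic_integral_T\<close>), and by transitivity \<open>T\<^sup>n 0\<close> has bounded oscillation.

  \<^emph>\<open>Fixed points.\<close> For a bounded Lipschitz \<open>\<phi>\<close>, the infimum \<open>g\<close> of the \<open>T\<^sup>n \<phi>\<close> satisfies \<open>g \<le> T g\<close>, so the
  \<open>T\<^sup>n g\<close> increase, and their supremum is a Lipschitz fixed point.

  \<^emph>\<open>Restriction is isometric and injective.\<close> For a calibrated \<open>u\<close>, any \<open>x\<close> has a backward orbit along
  which \<open>u\<close> changes exactly by the Birkhoff sums; any other sub-action \<open>v\<close> changes by at least as
  much, so \<open>v - u\<close> does not decrease. The backward orbit accumulates at a point of \<open>\<Omega>\<close>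
  (\<open>compare_at_\<Omega>\<close>), hence \<open>v - u\<close> has the same supremum on \<open>\<Omega>\<close> as on the whole shift space.

  \<^emph>\<open>Restriction is surjective.\<close> Extend an admissible \<open>f\<close> from \<open>\<Omega>\<close> by the McShane formula
  \<open>\<phi> z = inf (f x + K' d z x)\<close> and apply the construction of fixed points. Admissibility gives
  \<open>f \<le> T\<^sup>n \<phi>\<close> on \<open>\<Omega>\<close>, because a path that starts in \<open>\<Omega>\<close> and ends near \<open>x \<in> \<Omega>\<close> can be continued along
  almost free returns to \<open>x\<close> until it is as close to \<open>x\<close> as desired (\<open>long_return\<close>); and a continuous
  sub-action is fixed by \<open>T\<close> at the points of \<open>\<Omega>\<close> (\<open>subaction_T_eq_on_\<Omega>\<close>). So nothing changes on \<open>\<Omega>\<close>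
  after the first step, and the fixed point extends \<open>f\<close>.
\<close>

section \<open>Cylinders and cluster points\<close>

text \<open>
  Points with a common prefix of length \<open>n\<close>. Distances, continuity and Hoelder conditions are all
  expressed through this relation, which makes them independent of \<open>lam\<close>.
\<close>

definition agree :: "nat \<Rightarrow> (nat \<Rightarrow> nat) \<Rightarrow> (nat \<Rightarrow> nat) \<Rightarrow> bool"
  where "agree n x y \<longleftrightarrow> (\<forall>j<n. x j = y j)"

definition graft :: "nat \<Rightarrow> (nat \<Rightarrow> nat) \<Rightarrow> (nat \<Rightarrow> nat) \<Rightarrow> nat \<Rightarrow> nat"
  where "graft k z x = (\<lambda>j. if j < k then z j else x (j - k))"

lemma agree_refl [simp]: "agree n x x"
  by (simp add: agree_def)

lemma agree_sym: "agree n x y \<Longrightarrow> agree n y x"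
  by (simp add: agree_def)

lemma agree_trans: "agree n x y \<Longrightarrow> agree n y z \<Longrightarrow> agree n x z"
  by (simp add: agree_def)

lemma agree_mono: "agree n x y \<Longrightarrow> m \<le> n \<Longrightarrow> agree m x y"
  by (simp add: agree_def)

lemma agree_1 [simp]: "agree (Suc 0) x y \<longleftrightarrow> x 0 = y 0"
  by (auto simp: agree_def)

lemma funpow_left_shift: "(left_shift ^^ k) x = (\<lambda>j. x (k + j))"
  by (induction k arbitrary: x) (auto simp: left_shift_def funpow_swap1)

lemma funpow_left_shift_graft [simp]: "(left_shift ^^ k) (graft k z x) = x"
  by (auto simp: funpow_left_shift graft_def)

lemma left_shift_tau [simp]: "left_shift (tau p) = snd p"
  by (auto simp: left_shift_def tau_def split: prod.splits)

lemma tau_0 [simp]: "tau p 0 = fst p 0"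
  by (auto simp: tau_def split: prod.splits)

lemma seq_eqI_shift:
  assumes "x 0 = y 0" "left_shift x = left_shift y"
  shows "x = y"
proof
  fix j show "x j = y j"
    using assms by (cases j) (auto simp: left_shift_def fun_eq_iff)
qed

lemma agree_graft:
  assumes "(left_shift ^^ k) z = x" "agree n x' x"
  shows "agree (k + n) (graft k z x') z"
  using assms by (fastforce simp: agree_def graft_def funpow_left_shift fun_eq_iff)

lemma agree_Suc_iff: "agree (Suc n) x y \<longleftrightarrow> x 0 = y 0 \<and> agree n (left_shift x) (left_shift y)"
  by (auto simp: agree_def left_shift_def less_Suc_eq_0_disj)

lemma agree_le_seq_dist:
  assumes "0 < \<rho>" "\<rho> < 1"
  shows "seq_dist \<rho> x y \<le> \<rho> ^ n \<longleftrightarrow> agree n x y"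
proof (cases "x = y")
  case True
  then show ?thesis using assms by (simp add: seq_dist_def)
next
  case False
  then have ne: "\<exists>j. x j \<noteq> y j" by auto
  have "seq_dist \<rho> x y \<le> \<rho> ^ n \<longleftrightarrow> n \<le> (LEAST j. x j \<noteq> y j)"
    using False assms by (simp add: seq_dist_def)
  also have "\<dots> \<longleftrightarrow> agree n x y"
    unfolding agree_def
    by (metis (mono_tags, lifting) LeastI_ex[OF ne] Least_le le_less_trans not_le)
  finally show ?thesis .
qed

text \<open>
  In either metric the only balls that matter are those of radius \<open>\<rho>\<^sup>n\<close>, and for sequences
  these are cylinders.
\<close>

lemma continuous_map_geometric_radii:
  fixes f :: "'a \<Rightarrow> real"
  assumes "Metric_space X d" "0 < \<rho>" "\<rho> < 1"
  shows "continuous_map (Metric_space.mtopology X d) euclideanreal f \<longleftrightarrow>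
    (\<forall>x\<in>X. \<forall>\<epsilon>>0. \<exists>n. \<forall>y\<in>X. d x y \<le> \<rho> ^ n \<longrightarrow> \<bar>f x - f y\<bar> < \<epsilon>)"
proof -
  have *: "(\<exists>\<delta>>0. \<forall>y\<in>X. d x y < \<delta> \<longrightarrow> P y) \<longleftrightarrow> (\<exists>n. \<forall>y\<in>X. d x y \<le> \<rho> ^ n \<longrightarrow> P y)"
    for x and P :: "'a \<Rightarrow> bool"
  proof safe
    fix \<delta> :: real assume "0 < \<delta>" and P: "\<forall>y\<in>X. d x y < \<delta> \<longrightarrow> P y"
    then obtain n where "\<rho> ^ n < \<delta>" using real_arch_pow_inv assms by blast
    then show "\<exists>n. \<forall>y\<in>X. d x y \<le> \<rho> ^ n \<longrightarrow> P y" using P by (meson le_less_trans)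
  next
    fix n assume "\<forall>y\<in>X. d x y \<le> \<rho> ^ n \<longrightarrow> P y"
    then show "\<exists>\<delta>>0. \<forall>y\<in>X. d x y < \<delta> \<longrightarrow> P y"
      using assms by (intro exI[of _ "\<rho> ^ n"]) auto
  qed
  have "continuous_map (Metric_space.mtopology X d) euclideanreal f \<longleftrightarrow>
    (\<forall>x\<in>X. \<forall>\<epsilon>>0. \<exists>\<delta>>0. \<forall>y\<in>X. d x y < \<delta> \<longrightarrow> \<bar>f x - f y\<bar> < \<epsilon>)"
    using Metric_space.metric_continuous_map[OF assms(1) Met_TC.Metric_space_axioms, of f]
    by (simp add: dist_real_def Ball_def Bex_def imp_conjL)
  then show ?thesis unfolding * .
qed

lemma continuous_map_seq_top:
  assumes "0 < lam" "lam < 1"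
  shows "continuous_map (seq_top lam X) euclideanreal f \<longleftrightarrow>
    (\<forall>x\<in>X. \<forall>\<epsilon>>0. \<exists>n. \<forall>y\<in>X. agree n x y \<longrightarrow> \<bar>f x - f y\<bar> < \<epsilon>)"
  using continuous_map_geometric_radii[OF Metric_space_seq_dist[OF assms] assms]
  by (simp add: agree_le_seq_dist[OF assms])

lemma continuous_map_ext_top:
  assumes "0 < lam" "lam < 1"
  shows "continuous_map (ext_top lam X) euclideanreal f \<longleftrightarrow>
    (\<forall>p\<in>X. \<forall>\<epsilon>>0. \<exists>n. \<forall>q\<in>X. agree n (fst p) (fst q) \<and> agree n (snd p) (snd q) \<longrightarrow>
      \<bar>f p - f q\<bar> < \<epsilon>)"
  using continuous_map_geometric_radii[OF Metric_space_ext_dist[OF assms] assms]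
  by (simp add: ext_dist_def agree_le_seq_dist[OF assms])

text \<open>
  Compactness of the product of finite sets, by successively choosing a symbol that occurs infinitely
  often. It is used for sequences in the shift space and in its dual; both are defined by conditions
  on neighbouring symbols, which pass to cluster points.
\<close>

lemma seq_cluster_point:
  fixes X :: "nat \<Rightarrow> nat \<Rightarrow> nat"
  assumes "\<And>i j. X i j \<in> F" "finite F"
  obtains \<zeta> where "\<And>n. infinite {i. agree n (X i) \<zeta>}"
proof -
  define P where "P n w \<longleftrightarrow> infinite {i. agree n (X i) w}" for n and w :: "nat \<Rightarrow> nat"
  have "\<exists>w. P (0::nat) w" by (auto simp: P_def agree_def)
  moreover have "\<exists>w'. P (Suc n) w' \<and> agree n w w'" if "P n w" for n w
  proof -
    have "{i. agree n (X i) w} = (\<Union>s\<in>F. {i. agree (Suc n) (X i) (w(n := s))})"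
      using assms(1) by (auto simp: agree_def less_Suc_eq)
    then have "infinite (\<Union>s\<in>F. {i. agree (Suc n) (X i) (w(n := s))})"
      using that unfolding P_def by metis
    then obtain s where "infinite {i. agree (Suc n) (X i) (w(n := s))}"
      using assms(2) by blast
    then show ?thesis by (intro exI[of _ "w(n := s)"]) (auto simp: P_def agree_def)
  qed
  ultimately obtain w where P: "\<And>n. P n (w n)" and step: "\<And>n. agree n (w n) (w (Suc n))"
    using dependent_nat_choice[of P "\<lambda>n w w'. agree n w w'"] by metis
  have mono: "agree n (w n) (w (n + k))" for n k
  proof (induction k)
    case (Suc k)
    have "agree n (w (n + k)) (w (n + Suc k))" using agree_mono[OF step[of "n + k"]] by simp
    then show ?case using Suc agree_trans by blast
  qed simp
  have "agree n (w n) (\<lambda>j. w (Suc j) j)" for n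
    unfolding agree_def
  proof safe
    fix j assume "j < n"
    then have "agree (Suc j) (w (Suc j)) (w n)" using mono[of "Suc j" "n - Suc j"] by simp
    then show "w n j = w (Suc j) j" by (simp add: agree_def)
  qed
  then have "{i. agree n (X i) (w n)} = {i. agree n (X i) (\<lambda>j. w (Suc j) j)}" for n
    using agree_sym agree_trans by blast
  then show ?thesis using P that unfolding P_def by metis
qed

lemma cluster_point_local:
  assumes "\<And>n. infinite {i. agree n (X i) \<zeta>}" "\<And>i. R (X i j) (X i (Suc j))"
  shows "R (\<zeta> j) (\<zeta> (Suc j))"
proof -
  obtain i where "agree (j + 2) (X i) \<zeta>" using infinite_imp_nonempty[OF assms(1)[of "j + 2"]] by auto
  then have "X i j = \<zeta> j" "X i (Suc j) = \<zeta> (Suc j)" by (simp_all add: agree_def)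
  then show ?thesis using assms(2)[of i] by simp
qed

lemma sft_cluster_point:
  fixes X :: "nat \<Rightarrow> nat \<Rightarrow> nat"
  assumes "\<And>i. X i \<in> sft r M"
  obtains \<zeta> where "\<zeta> \<in> sft r M" "\<And>n. infinite {i. agree n (X i) \<zeta>}"
proof -
  have X: "X i j \<in> {1..r} \<and> M (X i j) (X i (Suc j)) = 1" for i j
    using assms[of i] by (auto simp: sft_def)
  obtain \<zeta> where \<zeta>: "\<And>n. infinite {i. agree n (X i) \<zeta>}"
    using seq_cluster_point[of X "{1..r}"] X by blast
  have "\<zeta> j \<in> {1..r} \<and> M (\<zeta> j) (\<zeta> (Suc j)) = 1" for j
    using cluster_point_local[OF \<zeta>, of "\<lambda>s t. s \<in> {1..r} \<and> M s t = 1"] X by blast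
  then show ?thesis using \<zeta> that by (auto simp: sft_def)
qed

lemma sft_dual_cluster_point:
  fixes X :: "nat \<Rightarrow> nat \<Rightarrow> nat"
  assumes "\<And>i. X i \<in> sft_dual r M"
  obtains \<zeta> where "\<zeta> \<in> sft_dual r M" "\<And>n. infinite {i. agree n (X i) \<zeta>}"
proof -
  have X: "X i j \<in> {1..r} \<and> M (X i (Suc j)) (X i j) = 1" for i j
    using assms[of i] by (auto simp: sft_dual_def)
  obtain \<zeta> where \<zeta>: "\<And>n. infinite {i. agree n (X i) \<zeta>}"
    using seq_cluster_point[of X "{1..r}"] X by blast
  have "\<zeta> j \<in> {1..r} \<and> M (\<zeta> (Suc j)) (\<zeta> j) = 1" for j
    using cluster_point_local[OF \<zeta>, of "\<lambda>s t. s \<in> {1..r} \<and> M t s = 1"] X by blast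
  then show ?thesis using \<zeta> that by (auto simp: sft_dual_def)
qed

lemma sft_funpow [simp]: "x \<in> sft r M \<Longrightarrow> (left_shift ^^ k) x \<in> sft r M"
  by (auto simp: sft_def funpow_left_shift)

lemma sft_left_shift [simp]: "x \<in> sft r M \<Longrightarrow> left_shift x \<in> sft r M"
  by (auto simp: sft_def left_shift_def)

lemma sft_graft:
  assumes "z \<in> sft r M" "x \<in> sft r M" "x 0 = z k"
  shows "graft k z x \<in> sft r M"
proof -
  have "graft k z x j \<in> {1..r}" for j using assms by (auto simp: graft_def sft_def)
  moreover have "M (graft k z x j) (graft k z x (Suc j)) = 1" for j
  proof -
    consider "Suc j < k" | "Suc j = k" | "k \<le> j" by linarith
    then show ?thesis
      using assms by cases (auto simp: graft_def sft_def Suc_diff_le)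
  qed
  ultimately show ?thesis by (auto simp: sft_def)
qed

lemma tau_in_sft: "p \<in> sft_ext r M \<Longrightarrow> tau p \<in> sft r M"
  by (auto simp: sft_ext_def sft_def sft_dual_def tau_def split: nat.splits)

lemma snd_in_sft: "p \<in> sft_ext r M \<Longrightarrow> snd p \<in> sft r M"
  by (auto simp: sft_ext_def)

lemma tau_eq:
  assumes "y 0 = z 0"
  shows "tau (y, left_shift z) = z"
  by (rule seq_eqI_shift) (use assms in auto)

lemma sft_ext_iff:
  "(y, left_shift z) \<in> sft_ext r M \<longleftrightarrow> y \<in> sft_dual r M"
  if "z \<in> sft r M" "y 0 = z 0"
  using that by (auto simp: sft_ext_def sft_def sft_dual_def left_shift_def)

section \<open>Transitive subshifts\<close>

locale transitive_sft =
  fixes r :: nat and M :: "nat \<Rightarrow> nat \<Rightarrow> nat" and lam :: real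
  assumes nonempty: "sft r M \<noteq> {}"
    and lam: "0 < lam" "lam < 1"
    and transitive: "transitive_map (seq_top lam (sft r M)) left_shift"
begin

abbreviation \<Sigma> where "\<Sigma> \<equiv> sft r M"

lemma openin_cylinder: "openin (seq_top lam \<Sigma>) {x \<in> \<Sigma>. x 0 = i}"
proof -
  interpret Metric_space \<Sigma> "seq_dist lam" by (rule Metric_space_seq_dist[OF lam])
  have "mball x lam \<subseteq> {y \<in> \<Sigma>. y 0 = x 0}" for x
  proof
    fix y assume y: "y \<in> mball x lam"
    then have "agree 1 x y" using agree_le_seq_dist[OF lam, of x y 1] by simp
    then show "y \<in> {y \<in> \<Sigma>. y 0 = x 0}" using y by simp
  qed
  then have "\<exists>e>0. mball x e \<subseteq> {y \<in> \<Sigma>. y 0 = i}" if "x 0 = i" for x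
    using that lam(1) by blast
  then show ?thesis unfolding openin_mtopology by (metis (mono_tags, lifting) mem_Collect_eq subsetI)
qed

lemma connecting_word:
  assumes "x \<in> \<Sigma>" "x' \<in> \<Sigma>"
  obtains k z where "k \<ge> 1" "z \<in> \<Sigma>" "z 0 = x 0" "z k = x' 0"
proof -
  let ?C = "\<lambda>i. {z \<in> \<Sigma>. z 0 = i}"
  have "?C (x 0) \<noteq> {}" "?C (x' 0) \<noteq> {}" using assms by auto
  then obtain k where k: "k \<ge> 1" "(left_shift ^^ k) ` ?C (x 0) \<inter> ?C (x' 0) \<noteq> {}"
    using transitive openin_cylinder[of "x 0"] openin_cylinder[of "x' 0"]
    unfolding transitive_map_def by meson
  then obtain z where "z \<in> \<Sigma>" "z 0 = x 0" "(left_shift ^^ k) z 0 = x' 0" by blast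
  then show ?thesis using that k by (simp add: funpow_left_shift)
qed

text \<open>
  Only the first symbols of \<open>x\<close> and \<open>x'\<close> matter, so finitely many words serve for all pairs.
\<close>

lemma bounded_connecting_words:
  obtains L where "\<And>x x'. x \<in> \<Sigma> \<Longrightarrow> x' \<in> \<Sigma> \<Longrightarrow> \<exists>k z. 1 \<le> k \<and> k \<le> L \<and> z \<in> \<Sigma> \<and> z 0 = x 0 \<and> z k = x' 0"
proof -
  define S where "S = (\<lambda>x::nat \<Rightarrow> nat. x 0) ` \<Sigma>"
  define Q where "Q p k \<longleftrightarrow> k \<ge> 1 \<and> (\<exists>z\<in>\<Sigma>. z 0 = fst p \<and> z k = snd p)" for p k
  have "S \<subseteq> {1..r}" by (auto simp: S_def sft_def)
  then have "finite (S \<times> S)" by (auto intro: finite_subset)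
  moreover have "\<forall>p\<in>S \<times> S. \<exists>k. Q p k" unfolding S_def Q_def
    by safe (metis connecting_word fst_conv snd_conv)
  then obtain k where k: "\<And>p. p \<in> S \<times> S \<Longrightarrow> Q p (k p)" by metis
  ultimately have k_le: "k p \<le> Max (k ` (S \<times> S))" if "p \<in> S \<times> S" for p using that by auto
  then show ?thesis
  proof (intro that)
    fix x x' assume "x \<in> \<Sigma>" "x' \<in> \<Sigma>"
    then have p: "(x 0, x' 0) \<in> S \<times> S" by (auto simp: S_def)
    then show "\<exists>l z. 1 \<le> l \<and> l \<le> Max (k ` (S \<times> S)) \<and> z \<in> \<Sigma> \<and> z 0 = x 0 \<and> z l = x' 0"
      using k[OF p] k_le[OF p] unfolding Q_def by auto
  qed
qed

text \<open>
  Transitivity from the cylinder of \<open>x 0\<close> to itself produces a symbol that can precede \<open>x 0\<close>.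
\<close>

lemma preimage_exists:
  assumes "x \<in> \<Sigma>"
  obtains z where "z \<in> \<Sigma>" "left_shift z = x"
proof -
  obtain k z where kz: "k \<ge> 1" "z \<in> \<Sigma>" "z k = x 0" using connecting_word[OF assms assms] by metis
  let ?w = "graft 1 ((left_shift ^^ (k - 1)) z) x"
  have "(left_shift ^^ (k - 1)) z 1 = x 0" using kz by (simp add: funpow_left_shift)
  then have "?w \<in> \<Sigma>" using sft_funpow[OF kz(2)] assms by (intro sft_graft) simp_all
  moreover have "left_shift ?w = x" using funpow_left_shift_graft[of 1] by simp
  ultimately show ?thesis using that by blast
qed

lemma dual_exists:
  assumes "z \<in> \<Sigma>"
  obtains y where "y \<in> sft_dual r M" "y 0 = z 0"
proof -
  have "\<exists>w. \<forall>n. w n \<in> \<Sigma> \<and> (n = 0 \<longrightarrow> w n = z) \<and> left_shift (w (Suc n)) = w n"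
    using dependent_nat_choice[of "\<lambda>n w. w \<in> \<Sigma> \<and> (n = 0 \<longrightarrow> w = z)" "\<lambda>n w w'. left_shift w' = w"]
      assms preimage_exists by (metis old.nat.distinct(2))
  then obtain w where w: "\<And>n. w n \<in> \<Sigma>" "w 0 = z" "\<And>n. left_shift (w (Suc n)) = w n" by metis
  have "M (w (Suc n) 0) (w n 0) = 1" for n
    using w(1)[of "Suc n"] w(3)[of n, symmetric] by (simp add: sft_def left_shift_def)
  moreover have "w n 0 \<in> {1..r}" for n using w(1)[of n] by (simp add: sft_def)
  ultimately have "(\<lambda>n. w n 0) \<in> sft_dual r M" by (simp add: sft_dual_def)
  then show ?thesis using that[of "\<lambda>n. w n 0"] w(2) by simp
qed

lemma finite_preimages: "finite {z \<in> \<Sigma>. left_shift z = x}"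
proof (rule inj_on_finite[of "\<lambda>z. z 0"])
  show "inj_on (\<lambda>z. z 0) {z \<in> \<Sigma>. left_shift z = x}"
    by (rule inj_onI, rule seq_eqI_shift) simp_all
  show "(\<lambda>z. z 0) ` {z \<in> \<Sigma>. left_shift z = x} \<subseteq> {1..r}" by (auto simp: sft_def)
qed auto

lemma continuous_bounded:
  assumes "continuous_map (seq_top lam \<Sigma>) euclideanreal u"
  obtains B where "\<And>x. x \<in> \<Sigma> \<Longrightarrow> \<bar>u x\<bar> \<le> B"
proof (rule ccontr)
  assume "\<not> thesis"
  then have "\<forall>i::nat. \<exists>x\<in>\<Sigma>. \<bar>u x\<bar> > real i" using that by (meson not_le)
  then obtain X where X: "\<And>i. X i \<in> \<Sigma>" "\<And>i. \<bar>u (X i)\<bar> > real i" by metis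
  obtain \<zeta> where \<zeta>: "\<zeta> \<in> \<Sigma>" "\<And>n. infinite {i. agree n (X i) \<zeta>}"
    using sft_cluster_point[of X, OF X(1)] by metis
  obtain n where n: "\<And>y. y \<in> \<Sigma> \<Longrightarrow> agree n \<zeta> y \<Longrightarrow> \<bar>u \<zeta> - u y\<bar> < 1"
    using assms \<zeta>(1) unfolding continuous_map_seq_top[OF lam] by (metis zero_less_one)
  obtain i where "i > nat \<lceil>\<bar>u \<zeta>\<bar> + 1\<rceil>" "agree n (X i) \<zeta>"
    using \<zeta>(2)[of n] unfolding infinite_nat_iff_unbounded by blast
  then have "\<bar>u \<zeta> - u (X i)\<bar> < 1" "\<bar>u \<zeta>\<bar> + 1 < real i" using n[OF X(1)[of i]] agree_sym by auto linarith
  then show False using X(2)[of i] by linarith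
qed

end

section \<open>Birkhoff sums of Lipschitz potentials\<close>

lemma geometric_small:
  fixes \<rho> c \<epsilon> :: real
  assumes "0 < \<rho>" "\<rho> < 1" "0 < \<epsilon>"
  obtains m where "1 \<le> m" "n \<le> m" "c * \<rho> ^ m < \<epsilon>"
proof -
  have "(\<lambda>n. c * \<rho> ^ n) \<longlonglongrightarrow> c * 0"
    using assms by (intro tendsto_mult_left LIMSEQ_power_zero) auto
  then have "eventually (\<lambda>n. c * \<rho> ^ n < \<epsilon>) sequentially"
    using order_tendstoD(2)[of _ "c * 0" sequentially \<epsilon>] assms by simp
  then obtain m where m: "\<And>j. m \<le> j \<Longrightarrow> c * \<rho> ^ j < \<epsilon>" by (auto simp: eventually_sequentially)
  show ?thesis by (rule that[of "max 1 (max n m)"]) (auto intro: m)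
qed

lemma abs_INF_diff_le:
  fixes f h :: "'i \<Rightarrow> real"
  assumes "I \<noteq> {}" "bdd_below (f ` I)" "bdd_below (h ` I)" "\<And>i. i \<in> I \<Longrightarrow> \<bar>f i - h i\<bar> \<le> e"
  shows "\<bar>(INF i\<in>I. f i) - (INF i\<in>I. h i)\<bar> \<le> e"
proof -
  have *: "(INF i\<in>I. f i) - e \<le> (INF i\<in>I. h i)"
    if "bdd_below (f ` I)" "\<And>i. i \<in> I \<Longrightarrow> \<bar>f i - h i\<bar> \<le> e" for f h :: "'i \<Rightarrow> real"
  proof (rule cINF_greatest[OF assms(1)])
    fix i assume i: "i \<in> I"
    show "(INF i\<in>I. f i) - e \<le> h i" using cINF_lower[OF that(1) i] that(2)[OF i] by linarith
  qed
  show ?thesis using *[of f h] *[of h f] assms by (force simp: abs_le_iff abs_minus_commute)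
qed

lemma abs_SUP_diff_le:
  fixes f h :: "'i \<Rightarrow> real"
  assumes "I \<noteq> {}" "bdd_above (f ` I)" "bdd_above (h ` I)" "\<And>i. i \<in> I \<Longrightarrow> \<bar>f i - h i\<bar> \<le> e"
  shows "\<bar>(SUP i\<in>I. f i) - (SUP i\<in>I. h i)\<bar> \<le> e"
proof -
  have *: "(SUP i\<in>I. f i) \<le> (SUP i\<in>I. h i) + e"
    if "bdd_above (h ` I)" "\<And>i. i \<in> I \<Longrightarrow> \<bar>f i - h i\<bar> \<le> e" for f h :: "'i \<Rightarrow> real"
  proof (rule cSUP_least[OF assms(1)])
    fix i assume i: "i \<in> I"
    show "f i \<le> (SUP i\<in>I. h i) + e" using cSUP_upper[OF i that(1)] that(2)[OF i] by linarith
  qed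
  show ?thesis using *[of f h] *[of h f] assms by (force simp: abs_le_iff abs_minus_commute)
qed

definition birkhoff_sum :: "((nat \<Rightarrow> nat) \<Rightarrow> real) \<Rightarrow> nat \<Rightarrow> (nat \<Rightarrow> nat) \<Rightarrow> real"
  where "birkhoff_sum b n z = (\<Sum>j<n. b ((left_shift ^^ j) z))"

lemma birkhoff_sum_0 [simp]: "birkhoff_sum b 0 z = 0"
  by (simp add: birkhoff_sum_def)

lemma birkhoff_sum_Suc: "birkhoff_sum b (Suc n) z = birkhoff_sum b n z + b ((left_shift ^^ n) z)"
  by (simp add: birkhoff_sum_def)

lemma birkhoff_sum_Suc_shift: "birkhoff_sum b (Suc n) z = b z + birkhoff_sum b n (left_shift z)"
  unfolding birkhoff_sum_def sum.lessThan_Suc_shift by (simp add: funpow_swap1)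

lemma birkhoff_sum_add:
  "birkhoff_sum b (k + n) z = birkhoff_sum b k z + birkhoff_sum b n ((left_shift ^^ k) z)"
  by (induction k arbitrary: z) (auto simp: birkhoff_sum_Suc_shift funpow_swap1)

text \<open>
  The metric \<open>\<rho>\<^sup>n\<close> makes a Hoelder potential Lipschitz. The index is shifted by one because the
  potential \<open>b z\<close> will be a maximum of values \<open>A (y, \<sigma> z)\<close>, in which \<open>z\<close> appears with its first
  symbol removed.
\<close>

locale lipschitz_potential = transitive_sft +
  fixes b :: "(nat \<Rightarrow> nat) \<Rightarrow> real" and \<rho> C R :: real
  assumes \<rho>: "0 < \<rho>" "\<rho> < 1"
    and C_nonneg: "0 \<le> C"
    and b_lipschitz: "\<And>n z z'. z \<in> sft r M \<Longrightarrow> z' \<in> sft r M \<Longrightarrow> agree (Suc n) z z' \<Longrightarrow> \<bar>b z - b z'\<bar> \<le> C * \<rho> ^ n"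
    and b_bounded: "\<And>z. z \<in> sft r M \<Longrightarrow> \<bar>b z\<bar> \<le> R"
begin

abbreviation S where "S \<equiv> birkhoff_sum b"

text \<open>
  The distortion constant, the sum of the geometric series of the errors \<open>C * \<rho>\<^sup>j\<close>. It is also the
  smallest Lipschitz constant that the operator \<open>T\<close> is seen to preserve.
\<close>

definition K :: real where "K = C / (1 - \<rho>)"

lemma K_nonneg: "0 \<le> K"
  using C_nonneg \<rho> by (simp add: K_def)

lemma C_eq: "C = K * (1 - \<rho>)"
  using \<rho> by (simp add: K_def)

lemma R_nonneg: "0 \<le> R"
  using b_bounded nonempty by fastforce

lemma birkhoff_sum_abs_le: "z \<in> \<Sigma> \<Longrightarrow> \<bar>S n z\<bar> \<le> real n * R"
proof (induction n)
  case (Suc n)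
  then show ?case using b_bounded[OF sft_funpow[OF Suc.prems], of n]
    by (simp add: birkhoff_sum_Suc algebra_simps)
qed simp

text \<open>
  Two points that agree for \<open>m\<close> more symbols than are summed over are closest at the start, so
  their errors form a geometric series that is dominated by its last term.
\<close>

lemma birkhoff_sum_distortion:
  assumes "z \<in> \<Sigma>" "z' \<in> \<Sigma>" "agree (n + m) z z'" "1 \<le> m"
  shows "\<bar>S n z - S n z'\<bar> \<le> K * \<rho> ^ m"
proof -
  have "\<bar>S n z - S n z'\<bar> \<le> K * \<rho> ^ m * (1 - \<rho> ^ n)"
    using assms(1-3)
  proof (induction n arbitrary: z z')
    case (Suc n)
    have "agree (n + m) (left_shift z) (left_shift z')" using Suc.prems by (simp add: agree_Suc_iff)
    then have "\<bar>S n (left_shift z) - S n (left_shift z')\<bar> \<le> K * \<rho> ^ m * (1 - \<rho> ^ n)"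
      using Suc by simp
    moreover have "\<bar>b z - b z'\<bar> \<le> K * (1 - \<rho>) * \<rho> ^ (n + m)"
      using b_lipschitz[of z z' "n + m"] Suc.prems unfolding C_eq[symmetric] by simp
    moreover have "K * (1 - \<rho>) * \<rho> ^ (n + m) + K * \<rho> ^ m * (1 - \<rho> ^ n) = K * \<rho> ^ m * (1 - \<rho> ^ Suc n)"
      by (simp add: power_add algebra_simps)
    ultimately show ?case unfolding birkhoff_sum_Suc_shift by linarith
  qed simp
  also have "\<dots> \<le> K * \<rho> ^ m * 1"
    using K_nonneg \<rho> by (intro mult_left_mono) auto
  finally show ?thesis by simp
qed

text \<open>
  The first \<open>n\<close> symbols of \<open>z\<close>, followed by a word that leads back from \<open>z n\<close> to \<open>z 0\<close>, can be repeated
  periodically. The periodic point shadows \<open>z\<close>, so by bounded distortion it loses at most \<open>K\<close> along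
  \<open>z\<close>, and at most \<open>L * R\<close> along the connecting word.
\<close>

lemma closing:
  obtains L where "\<And>n z. z \<in> \<Sigma> \<Longrightarrow>
    \<exists>k p. 1 \<le> k \<and> n \<le> k \<and> p \<in> \<Sigma> \<and> (left_shift ^^ k) p = p \<and> k \<le> n + L \<and> S n z \<le> S k p + K + real L * R"
proof -
  obtain L where L: "\<And>x x'. x \<in> \<Sigma> \<Longrightarrow> x' \<in> \<Sigma> \<Longrightarrow>
      \<exists>k z. 1 \<le> k \<and> k \<le> L \<and> z \<in> \<Sigma> \<and> z 0 = x 0 \<and> z k = x' 0"
    using bounded_connecting_words by metis
  have "\<exists>k p. 1 \<le> k \<and> n \<le> k \<and> p \<in> \<Sigma> \<and> (left_shift ^^ k) p = p \<and> k \<le> n + L \<and> S n z \<le> S k p + K + real L * R"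
    if z: "z \<in> \<Sigma>" for n z
  proof -
    obtain l x where x: "1 \<le> l" "l \<le> L" "x \<in> \<Sigma>" "x 0 = z n" "x l = z 0"
      using L[OF sft_funpow[OF z, of n] z] by (auto simp: funpow_left_shift)
    define w where "w = graft n z x"
    define p where "p j = w (j mod (n + l))" for j
    have w: "w \<in> \<Sigma>" unfolding w_def using z x by (intro sft_graft) auto
    have w_per: "w (n + l) = w 0" using x by (auto simp: w_def graft_def)
    have "M (p j) (p (Suc j)) = 1" for j
    proof -
      have "p (Suc j) = w (Suc (j mod (n + l)))"
        using w_per x(1) by (auto simp: p_def mod_Suc)
      then show ?thesis using w by (auto simp: p_def sft_def)
    qed
    then have p: "p \<in> \<Sigma>" using w by (auto simp: p_def sft_def)
    have per: "(left_shift ^^ (n + l)) p = p"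
      by (simp add: funpow_left_shift p_def fun_eq_iff)
    have "agree (n + 1) z p"
      using x by (auto simp: agree_def p_def w_def graft_def less_Suc_eq)
    then have "\<bar>S n z - S n p\<bar> \<le> K * \<rho> ^ 1" using z p by (intro birkhoff_sum_distortion) auto
    also have "\<dots> \<le> K" using K_nonneg \<rho> by (simp add: mult_left_le)
    finally have "\<bar>S n z - S n p\<bar> \<le> K" .
    moreover have "\<bar>S l ((left_shift ^^ n) p)\<bar> \<le> real l * R"
      using p by (intro birkhoff_sum_abs_le) simp
    moreover have "real l * R \<le> real L * R" using x R_nonneg by (intro mult_right_mono) auto
    ultimately have "S n z \<le> S (n + l) p + K + real L * R"
      unfolding birkhoff_sum_add by linarith
    then show ?thesis using p per x by (intro exI[of _ "n + l"] exI[of _ p]) auto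
  qed
  then show ?thesis using that by blast
qed

section \<open>The Lax-Oleinik operator\<close>

text \<open>
  The Lax-Oleinik operator. Its \<open>n\<close>-th iterate minimises \<open>w z - S n z\<close> over the \<open>n\<close>-fold preimages
  \<open>z\<close> of \<open>x\<close>, that is, over all backward paths of length \<open>n\<close>.
\<close>

definition T :: "((nat \<Rightarrow> nat) \<Rightarrow> real) \<Rightarrow> (nat \<Rightarrow> nat) \<Rightarrow> real"
  where "T w x = Min ((\<lambda>z. w z - b z) ` {z \<in> \<Sigma>. left_shift z = x})"

lemma T_le: "z \<in> \<Sigma> \<Longrightarrow> T w (left_shift z) \<le> w z - b z"
  unfolding T_def using finite_preimages by (intro Min_le) auto

lemma T_attained:
  assumes "x \<in> \<Sigma>"
  obtains z where "z \<in> \<Sigma>" "left_shift z = x" "T w x = w z - b z"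
proof -
  have "{z \<in> \<Sigma>. left_shift z = x} \<noteq> {}" using preimage_exists[OF assms] by blast
  then have "T w x \<in> (\<lambda>z. w z - b z) ` {z \<in> \<Sigma>. left_shift z = x}"
    unfolding T_def using finite_preimages by (intro Min_in) auto
  then show ?thesis using that by auto
qed

lemma T_mono:
  assumes "\<And>z. z \<in> \<Sigma> \<Longrightarrow> w z \<le> w' z + e" "x \<in> \<Sigma>"
  shows "T w x \<le> T w' x + e"
proof -
  obtain z where z: "z \<in> \<Sigma>" "left_shift z = x" "T w' x = w' z - b z" using T_attained[OF assms(2)] .
  then show ?thesis using T_le[OF z(1), of w] assms(1)[OF z(1)] by simp
qed

lemma T_iter_mono:
  assumes "\<And>z. z \<in> \<Sigma> \<Longrightarrow> w z \<le> w' z + e" "x \<in> \<Sigma>"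
  shows "(T ^^ n) w x \<le> (T ^^ n) w' x + e"
  using assms(2) by (induction n arbitrary: x) (auto intro: T_mono assms(1))

lemma T_iter_le: "z \<in> \<Sigma> \<Longrightarrow> (T ^^ n) w ((left_shift ^^ n) z) \<le> w z - S n z"
proof (induction n)
  case (Suc n)
  then show ?case using T_le[OF sft_funpow[OF Suc.prems], of "(T ^^ n) w" n]
    by (simp add: birkhoff_sum_Suc)
qed simp

lemma T_iter_attained:
  assumes "x \<in> \<Sigma>"
  shows "\<exists>z\<in>\<Sigma>. (left_shift ^^ n) z = x \<and> (T ^^ n) w x = w z - S n z"
  using assms
proof (induction n arbitrary: x)
  case (Suc n)
  obtain z1 where z1: "z1 \<in> \<Sigma>" "left_shift z1 = x" "T ((T ^^ n) w) x = (T ^^ n) w z1 - b z1"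
    using T_attained[OF Suc.prems] .
  obtain z where "z \<in> \<Sigma>" "(left_shift ^^ n) z = z1" "(T ^^ n) w z1 = w z - S n z"
    using Suc.IH[OF z1(1)] by blast
  then show ?case using z1 by (intro bexI[of _ z]) (auto simp: birkhoff_sum_Suc)
qed auto

text \<open>
  Points with different first symbols are not compared: the symbols that can precede them are
  unrelated, so \<open>T\<close> need not preserve a bound between them.
\<close>

definition lipschitz :: "real \<Rightarrow> ((nat \<Rightarrow> nat) \<Rightarrow> real) \<Rightarrow> bool"
  where "lipschitz K' w \<longleftrightarrow>
    (\<forall>x\<in>\<Sigma>. \<forall>y\<in>\<Sigma>. \<forall>n\<ge>1. agree n x y \<longrightarrow> \<bar>w x - w y\<bar> \<le> K' * \<rho> ^ n)"

lemma lipschitzD: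
  "lipschitz K' w \<Longrightarrow> x \<in> \<Sigma> \<Longrightarrow> y \<in> \<Sigma> \<Longrightarrow> agree n x y \<Longrightarrow> 1 \<le> n \<Longrightarrow> \<bar>w x - w y\<bar> \<le> K' * \<rho> ^ n"
  by (auto simp: lipschitz_def)

lemma lipschitz_continuous:
  assumes "lipschitz K' w"
  shows "continuous_map (seq_top lam \<Sigma>) euclideanreal w"
  unfolding continuous_map_seq_top[OF lam]
proof (intro ballI allI impI)
  fix x \<epsilon> assume x: "x \<in> \<Sigma>" "(0::real) < \<epsilon>"
  obtain n where n: "1 \<le> n" "K' * \<rho> ^ n < \<epsilon>" using geometric_small[OF \<rho> x(2)] by metis
  then show "\<exists>n. \<forall>y\<in>\<Sigma>. agree n x y \<longrightarrow> \<bar>w x - w y\<bar> < \<epsilon>"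
    using lipschitzD[OF assms x(1) _ _ n(1)] by (intro exI[of _ n]) force
qed

text \<open>
  An optimal preimage \<open>z\<close> of \<open>x\<close> can be copied to \<open>y\<close> by prepending the same symbol. The preimages
  agree for one symbol more, so the error contributed by \<open>w\<close> shrinks by the factor \<open>\<rho>\<close>, which leaves
  room for the error of \<open>b\<close> as soon as \<open>K \<le> K'\<close>.
\<close>

lemma T_lipschitz:
  assumes w: "lipschitz K' w" and K': "K \<le> K'"
  shows "lipschitz K' (T w)"
proof -
  have *: "T w y \<le> T w x + K' * \<rho> ^ n" if xy: "x \<in> \<Sigma>" "y \<in> \<Sigma>" "1 \<le> n" "agree n x y" for x y n
  proof -
    obtain z where z: "z \<in> \<Sigma>" "left_shift z = x" "T w x = w z - b z" using T_attained[OF xy(1)] .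
    define z' where "z' = graft 1 z y"
    have "z 1 = x 0" using z(2) by (auto simp: left_shift_def)
    moreover have "x 0 = y 0" using xy by (simp add: agree_def)
    ultimately have z': "z' \<in> \<Sigma>" unfolding z'_def using z xy by (intro sft_graft) auto
    have shz': "left_shift z' = y" using funpow_left_shift_graft[of 1 z y] by (simp add: z'_def)
    have "z' 0 = z 0" by (simp add: z'_def graft_def)
    then have ag: "agree (Suc n) z z'" using z(2) shz' xy(4) by (simp add: agree_Suc_iff)
    have "\<bar>b z - b z'\<bar> \<le> K * (1 - \<rho>) * \<rho> ^ n"
      using b_lipschitz[OF z(1) z' ag] unfolding C_eq[symmetric] .
    also have "\<dots> \<le> K' * (1 - \<rho>) * \<rho> ^ n" using K' \<rho> by (intro mult_right_mono) auto
    finally have "\<bar>b z - b z'\<bar> \<le> K' * \<rho> ^ n - K' * \<rho> ^ Suc n" by (simp add: algebra_simps)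
    moreover have "\<bar>w z - w z'\<bar> \<le> K' * \<rho> ^ Suc n" using lipschitzD[OF w z(1) z' ag] by simp
    ultimately show ?thesis using T_le[OF z', of w] unfolding shz' z(3) by linarith
  qed
  show ?thesis unfolding lipschitz_def
  proof (intro ballI allI impI)
    fix x y n assume "x \<in> \<Sigma>" "y \<in> \<Sigma>" "1 \<le> (n::nat)" "agree n x y"
    then show "\<bar>T w x - T w y\<bar> \<le> K' * \<rho> ^ n" using *[of x y n] *[of y x n] agree_sym by fastforce
  qed
qed

lemma T_iter_lipschitz: "lipschitz K' w \<Longrightarrow> K \<le> K' \<Longrightarrow> lipschitz K' ((T ^^ n) w)"
  by (induction n) (auto intro: T_lipschitz)

lemma T_iter_zero_lipschitz: "lipschitz K ((T ^^ n) (\<lambda>_. 0))"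
  using K_nonneg \<rho> by (intro T_iter_lipschitz) (auto simp: lipschitz_def)

text \<open>
  By the Lipschitz bound only first symbols matter. A word that leads from the symbol of \<open>x'\<close> to that
  of \<open>x\<close> compares \<open>T\<^sup>n\<^sup>+\<^sup>l 0\<close> at \<open>x\<close> with \<open>T\<^sup>n 0\<close> at \<open>x'\<close>; the change of the exponent costs as much as
  the word, since \<open>T\<^sup>l 0\<close> differs from \<open>0\<close> by at most \<open>l * R\<close>.
\<close>

lemma T_iter_zero_oscillation:
  obtains D where "\<And>n x x'. x \<in> \<Sigma> \<Longrightarrow> x' \<in> \<Sigma> \<Longrightarrow> (T ^^ n) (\<lambda>_. 0) x \<le> (T ^^ n) (\<lambda>_. 0) x' + D"
proof -
  obtain L where L: "\<And>x x'. x \<in> \<Sigma> \<Longrightarrow> x' \<in> \<Sigma> \<Longrightarrow>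
      \<exists>k z. 1 \<le> k \<and> k \<le> L \<and> z \<in> \<Sigma> \<and> z 0 = x 0 \<and> z k = x' 0"
    using bounded_connecting_words by metis
  let ?m = "\<lambda>n. (T ^^ n) (\<lambda>_. 0::real)"
  have "?m n x \<le> ?m n x' + (2 * K + 2 * (real L * R))" if x: "x \<in> \<Sigma>" "x' \<in> \<Sigma>" for n x x'
  proof -
    obtain l v where v: "l \<le> L" "v \<in> \<Sigma>" "v 0 = x' 0" "v l = x 0" using L[OF x(2,1)] by auto
    have lR: "real l * R \<le> real L * R" using v R_nonneg by (intro mult_right_mono) auto
    have near: "?m n y \<le> ?m n y' + K" if "y \<in> \<Sigma>" "y' \<in> \<Sigma>" "y 0 = y' 0" for y y'
    proof -
      have "\<bar>?m n y - ?m n y'\<bar> \<le> K * \<rho> ^ 1"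
        using that by (intro lipschitzD[OF T_iter_zero_lipschitz]) auto
      also have "\<dots> \<le> K" using K_nonneg \<rho> by (simp add: mult_left_le)
      finally show ?thesis by linarith
    qed
    have "0 \<le> ?m l z + real l * R" if "z \<in> \<Sigma>" for z
      using T_iter_attained[OF that, of l "\<lambda>_. 0"] birkhoff_sum_abs_le[of _ l] by fastforce
    then have "?m n ((left_shift ^^ l) v) \<le> (T ^^ n) (?m l) ((left_shift ^^ l) v) + real l * R"
      using v by (intro T_iter_mono) auto
    also have "(T ^^ n) (?m l) = (T ^^ l) (?m n)"
      by (metis add.commute comp_apply funpow_add)
    also have "(T ^^ l) (?m n) ((left_shift ^^ l) v) \<le> ?m n v + real l * R"
      using T_iter_le[OF v(2), of l "?m n"] birkhoff_sum_abs_le[OF v(2), of l] by linarith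
    finally have "?m n ((left_shift ^^ l) v) \<le> ?m n v + 2 * (real l * R)" by (simp add: ac_simps)
    moreover have "?m n v \<le> ?m n x' + K" using near[OF v(2) x(2) v(3)] .
    moreover have "?m n x \<le> ?m n ((left_shift ^^ l) v) + K"
      using near[OF x(1) sft_funpow[OF v(2)], of l] v(4) by (simp add: funpow_left_shift)
    ultimately show ?thesis using lR by linarith
  qed
  then show ?thesis using that by blast
qed

end

section \<open>Calibrated functions as limits of Lax-Oleinik iterates\<close>

text \<open>
  Potentials whose maximal mean value is zero: their Birkhoff sums are bounded above, and every point
  is the end of arbitrarily long orbit segments whose sums are bounded below.
\<close>

locale normalised_potential = lipschitz_potential +
  fixes D :: real
  assumes S_le: "\<And>n z. z \<in> sft r M \<Longrightarrow> birkhoff_sum b n z \<le> D"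
    and T_iter_zero_le: "\<And>n x. x \<in> sft r M \<Longrightarrow> (T ^^ n) (\<lambda>_. 0) x \<le> D"
begin

definition subaction :: "((nat \<Rightarrow> nat) \<Rightarrow> real) \<Rightarrow> bool"
  where "subaction v \<longleftrightarrow> (\<forall>z\<in>\<Sigma>. v (left_shift z) \<le> v z - b z)"

definition calibrated :: "((nat \<Rightarrow> nat) \<Rightarrow> real) \<Rightarrow> bool"
  where "calibrated u \<longleftrightarrow> (\<forall>x\<in>\<Sigma>. T u x = u x)"

lemma calibrated_subaction: "calibrated u \<Longrightarrow> subaction u"
  unfolding calibrated_def subaction_def using T_le by (metis sft_left_shift)

lemma subaction_T_ge: "subaction v \<Longrightarrow> x \<in> \<Sigma> \<Longrightarrow> v x \<le> T v x"
  unfolding subaction_def by (metis T_attained)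

lemma subaction_iff: "subaction v \<longleftrightarrow> (\<forall>x\<in>\<Sigma>. v x \<le> T v x)"
proof
  assume "\<forall>x\<in>\<Sigma>. v x \<le> T v x"
  then show "subaction v" unfolding subaction_def using T_le by (meson order_trans sft_left_shift)
qed (simp add: subaction_T_ge)

lemma subaction_T: "subaction v \<Longrightarrow> subaction (T v)"
  unfolding subaction_iff using T_mono[of v "T v" 0] by auto

lemma subaction_T_iter: "subaction v \<Longrightarrow> subaction ((T ^^ n) v)"
  by (induction n) (auto intro: subaction_T)

lemma subaction_T_iter_ge: "subaction v \<Longrightarrow> x \<in> \<Sigma> \<Longrightarrow> v x \<le> (T ^^ n) v x"
proof (induction n)
  case (Suc n)
  then show ?case using subaction_T_ge[OF subaction_T_iter, of v x n] by auto
qed simp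

lemma subaction_path:
  assumes "subaction v" "z \<in> \<Sigma>"
  shows "v ((left_shift ^^ n) z) \<le> v z - S n z"
  using subaction_T_iter_ge[OF assms(1) sft_funpow[OF assms(2)]] T_iter_le[OF assms(2)] order_trans
  by blast

context
  fixes \<phi> :: "(nat \<Rightarrow> nat) \<Rightarrow> real" and K' B :: real
  assumes \<phi>_lipschitz: "lipschitz K' \<phi>" and K': "K \<le> K'"
    and \<phi>_bounded: "\<And>z. z \<in> \<Sigma> \<Longrightarrow> \<bar>\<phi> z\<bar> \<le> B"
begin

text \<open>
  The upper bound is that of \<open>T\<^sup>n 0\<close>, raised by \<open>B\<close>; the lower one holds because no Birkhoff sum
  exceeds \<open>D\<close>.
\<close>

lemma T_iter_bounds:
  assumes "x \<in> \<Sigma>"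
  shows "\<bar>(T ^^ n) \<phi> x\<bar> \<le> B + D"
proof -
  have "(T ^^ n) \<phi> x \<le> (T ^^ n) (\<lambda>_. 0) x + B"
    using \<phi>_bounded by (intro T_iter_mono assms) fastforce
  moreover have "- B - D \<le> (T ^^ n) \<phi> x"
  proof -
    obtain z where "z \<in> \<Sigma>" "(T ^^ n) \<phi> x = \<phi> z - S n z" using T_iter_attained[OF assms] by blast
    then show ?thesis using \<phi>_bounded[of z] S_le[of z n] by linarith
  qed
  ultimately show ?thesis using T_iter_zero_le[OF assms, of n] by linarith
qed

text \<open>
  The largest sub-action below \<open>\<phi>\<close>. Applying \<open>T\<close> to an infimum of iterates only drops the first of
  them, which can only make the infimum larger.
\<close>

definition subaction_envelope :: "(nat \<Rightarrow> nat) \<Rightarrow> real"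
  where "subaction_envelope x = (INF n. (T ^^ n) \<phi> x)"

text \<open>
  The iterates of a sub-action increase, so this supremum is a limit.
\<close>

definition calibrated_envelope :: "(nat \<Rightarrow> nat) \<Rightarrow> real"
  where "calibrated_envelope x = (SUP n. (T ^^ n) subaction_envelope x)"

lemma T_iter_bdd_below: "x \<in> \<Sigma> \<Longrightarrow> bdd_below (range (\<lambda>n. (T ^^ n) \<phi> x))"
  proof (intro bdd_belowI[of _ "- (B + D)"])
  fix t assume x: "x \<in> \<Sigma>" and "t \<in> range (\<lambda>n. (T ^^ n) \<phi> x)"
  then obtain n where "t = (T ^^ n) \<phi> x" by auto
  then show "- (B + D) \<le> t" using T_iter_bounds[OF x, of n] by linarith
qed

lemma subaction_envelope_le: "x \<in> \<Sigma> \<Longrightarrow> subaction_envelope x \<le> (T ^^ n) \<phi> x"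
  unfolding subaction_envelope_def by (intro cINF_lower T_iter_bdd_below) auto

lemma subaction_envelope_greatest: "(\<And>n. m \<le> (T ^^ n) \<phi> x) \<Longrightarrow> m \<le> subaction_envelope x"
  unfolding subaction_envelope_def by (intro cINF_greatest) auto

lemma subaction_envelope_subaction: "subaction subaction_envelope"
  unfolding subaction_def
proof
  fix z assume z: "z \<in> \<Sigma>"
  have "subaction_envelope (left_shift z) + b z \<le> (T ^^ n) \<phi> z" for n
    using subaction_envelope_le[of "left_shift z" "Suc n"] T_le[OF z, of "(T ^^ n) \<phi>"] z by force
  then have "subaction_envelope (left_shift z) + b z \<le> subaction_envelope z" by (rule subaction_envelope_greatest)
  then show "subaction_envelope (left_shift z) \<le> subaction_envelope z - b z" by linarith
qed

lemma subaction_envelope_lipschitz: "lipschitz K' subaction_envelope"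
  unfolding lipschitz_def
proof (intro ballI allI impI)
  fix x y n assume "x \<in> \<Sigma>" "y \<in> \<Sigma>" "1 \<le> (n::nat)" "agree n x y"
  then show "\<bar>subaction_envelope x - subaction_envelope y\<bar> \<le> K' * \<rho> ^ n"
    unfolding subaction_envelope_def
    by (intro abs_INF_diff_le T_iter_bdd_below lipschitzD[OF T_iter_lipschitz[OF \<phi>_lipschitz K']]) auto
qed

lemma T_iter_subaction_envelope_bdd_above: "x \<in> \<Sigma> \<Longrightarrow> bdd_above (range (\<lambda>n. (T ^^ n) subaction_envelope x))"
proof (intro bdd_aboveI[of _ "B + D"])
  fix t assume x: "x \<in> \<Sigma>" and "t \<in> range (\<lambda>n. (T ^^ n) subaction_envelope x)"
  then obtain n where "t = (T ^^ n) subaction_envelope x" by auto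
  also have "\<dots> \<le> (T ^^ n) \<phi> x + 0" using subaction_envelope_le[of _ 0] x by (intro T_iter_mono) auto
  finally show "t \<le> B + D" using T_iter_bounds[OF x, of n] by linarith
qed

lemma T_iter_subaction_envelope_le: "x \<in> \<Sigma> \<Longrightarrow> (T ^^ n) subaction_envelope x \<le> calibrated_envelope x"
  unfolding calibrated_envelope_def by (intro cSUP_upper T_iter_subaction_envelope_bdd_above) auto

lemma calibrated_envelope_lipschitz: "lipschitz K' calibrated_envelope"
  unfolding lipschitz_def
proof (intro ballI allI impI)
  fix x y n assume "x \<in> \<Sigma>" "y \<in> \<Sigma>" "1 \<le> (n::nat)" "agree n x y"
  then show "\<bar>calibrated_envelope x - calibrated_envelope y\<bar> \<le> K' * \<rho> ^ n"
    unfolding calibrated_envelope_def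
    by (intro abs_SUP_diff_le T_iter_subaction_envelope_bdd_above
        lipschitzD[OF T_iter_lipschitz[OF subaction_envelope_lipschitz K']]) auto
qed

lemma calibrated_envelope_calibrated: "calibrated calibrated_envelope"
  unfolding calibrated_def
proof
  fix x assume x: "x \<in> \<Sigma>"
  let ?w = "\<lambda>n. (T ^^ n) subaction_envelope"
  have "calibrated_envelope x \<le> T calibrated_envelope x"
    unfolding calibrated_envelope_def[of x]
  proof (intro cSUP_least)
    fix n
    have "?w n x \<le> T (?w n) x"
      using subaction_T_ge[OF subaction_T_iter[OF subaction_envelope_subaction] x] .
    also have "\<dots> \<le> T calibrated_envelope x + 0" using T_iter_subaction_envelope_le x by (intro T_mono) auto
    finally show "?w n x \<le> T calibrated_envelope x" by simp
  qed auto
  \<comment> \<open>If \<open>T\<close> strictly raised the limit at \<open>x\<close>, every preimage would exceed it from some iterate on, and by finiteness all of them at the same iterate \<open>N\<close>.\<close>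
  moreover have "T calibrated_envelope x \<le> calibrated_envelope x"
  proof (rule ccontr)
    assume less: "\<not> T calibrated_envelope x \<le> calibrated_envelope x"
    let ?F = "{z \<in> \<Sigma>. left_shift z = x}"
    have "\<exists>n. \<forall>k\<ge>n. calibrated_envelope x < ?w k z - b z" if zF: "z \<in> ?F" for z
    proof -
      have "calibrated_envelope x < calibrated_envelope z - b z" using less T_le[of z calibrated_envelope] zF by auto
      then have "calibrated_envelope x + b z < (SUP n. ?w n z)" by (simp add: calibrated_envelope_def[of z])
      then obtain n where n: "calibrated_envelope x + b z < ?w n z"
        using less_cSUP_iff[OF UNIV_not_empty T_iter_subaction_envelope_bdd_above] zF by auto
      have mono: "?w n z \<le> ?w (n + k) z" for k
        using subaction_T_iter_ge[OF subaction_T_iter[OF subaction_envelope_subaction, of n], of z k] zF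
        by (simp add: funpow_add add.commute[of n k])
      have "calibrated_envelope x < ?w k z - b z" if "n \<le> k" for k
        using mono[of "k - n"] n that by simp
      then show ?thesis by blast
    qed
    then have "\<exists>n. \<forall>z\<in>?F. \<forall>k\<ge>n z. calibrated_envelope x < ?w k z - b z" by (intro bchoice) blast
    then obtain n where n: "\<And>z k. z \<in> ?F \<Longrightarrow> n z \<le> k \<Longrightarrow> calibrated_envelope x < ?w k z - b z" by blast
    define N where "N = Max (n ` ?F)"
    have "n z \<le> N" if "z \<in> ?F" for z
      unfolding N_def using finite_preimages that by (intro Max_ge) auto
    then have N: "calibrated_envelope x < ?w N z - b z" if "z \<in> ?F" for z using n that by blast
    obtain z where "z \<in> ?F" "T (?w N) x = ?w N z - b z" using T_attained[OF x, of "?w N"] by blast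
    then have "calibrated_envelope x < T (?w N) x" using N by simp
    also have "\<dots> \<le> calibrated_envelope x" using T_iter_subaction_envelope_le[OF x, of "Suc N"] by simp
    finally show False by simp
  qed
  ultimately show "T calibrated_envelope x = calibrated_envelope x" by simp
qed

end

lemma calibrated_exists:
  obtains u where "calibrated u" "lipschitz K u"
proof -
  have "lipschitz K (\<lambda>_. 0)" using T_iter_zero_lipschitz[of 0] by simp
  then show ?thesis
    using that calibrated_envelope_calibrated calibrated_envelope_lipschitz by (metis abs_zero order_refl)
qed

section \<open>The non-wandering set\<close>

text \<open>
  The non-wandering set in terms of preimages: a path from \<open>x\<close> of length \<open>k\<close> is a point \<open>z\<close> with
  \<open>\<sigma>\<^sup>k z = x\<close>, and it ends at \<open>z\<close>.
\<close>

definition \<Omega> :: "(nat \<Rightarrow> nat) set"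
  where "\<Omega> = {x \<in> \<Sigma>. \<forall>\<epsilon>>0. \<forall>n. \<exists>k\<ge>1. \<exists>z\<in>\<Sigma>.
    (left_shift ^^ k) z = x \<and> agree n z x \<and> \<bar>S k z\<bar> < \<epsilon>}"

lemma \<Omega>_subset: "\<Omega> \<subseteq> \<Sigma>"
  by (auto simp: \<Omega>_def)

lemma \<Omega>_return:
  assumes "x \<in> \<Omega>" "0 < \<epsilon>"
  obtains k z where "1 \<le> k" "z \<in> \<Sigma>" "(left_shift ^^ k) z = x" "agree n z x" "\<bar>S k z\<bar> < \<epsilon>"
  using assms unfolding \<Omega>_def by blast

text \<open>
  A path can be started at any nearby point \<open>x\<close>: the same symbols are prepended to \<open>x\<close>. The end of the
  new path is even closer to the old end, by the length \<open>k\<close> of the path.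
\<close>

lemma transplant:
  assumes "z \<in> \<Sigma>" "x \<in> \<Sigma>" "agree m ((left_shift ^^ k) z) x" "1 \<le> m"
  shows "graft k z x \<in> \<Sigma>" "agree (k + m) (graft k z x) z"
    "\<bar>S k (graft k z x) - S k z\<bar> \<le> K * \<rho> ^ m"
proof -
  have "x 0 = z k" using assms(3,4) by (auto simp: agree_def funpow_left_shift)
  then show *: "graft k z x \<in> \<Sigma>" using assms by (intro sft_graft)
  show ag: "agree (k + m) (graft k z x) z" using assms(3) by (intro agree_graft) (auto simp: agree_sym)
  show "\<bar>S k (graft k z x) - S k z\<bar> \<le> K * \<rho> ^ m"
    using * ag assms by (intro birkhoff_sum_distortion)
qed

text \<open>
  Along a backward orbit \<open>X\<close> of \<open>x\<close> that realises the minima in \<open>T u = u\<close>, the function \<open>v - u\<close> does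
  not decrease. Two visits of \<open>X\<close> near a cluster point \<open>\<zeta>\<close> bound an orbit segment whose sum is a
  difference of two values of \<open>u\<close> near \<open>\<zeta>\<close>, hence small; started at \<open>\<zeta>\<close> itself, this segment shows
  that \<open>\<zeta> \<in> \<Omega>\<close>.
\<close>

lemma compare_at_\<Omega>:
  assumes u: "calibrated u" "continuous_map (seq_top lam \<Sigma>) euclideanreal u"
    and v: "subaction v" "continuous_map (seq_top lam \<Sigma>) euclideanreal v"
    and x: "x \<in> \<Sigma>"
  obtains \<zeta> where "\<zeta> \<in> \<Omega>" "v x - u x \<le> v \<zeta> - u \<zeta>"
proof -
  have "\<exists>z\<in>\<Sigma>. left_shift z = w \<and> u w = u z - b z" if "w \<in> \<Sigma>" for w
    using u(1) T_attained[OF that, of u] that unfolding calibrated_def by metis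
  then have "\<exists>X. \<forall>n. (X n \<in> \<Sigma> \<and> (n = 0 \<longrightarrow> X n = x)) \<and>
      (left_shift (X (Suc n)) = X n \<and> u (X n) = u (X (Suc n)) - b (X (Suc n)))"
    using x by (intro dependent_nat_choice) auto
  then obtain X where X: "\<And>n. X n \<in> \<Sigma>" "X 0 = x" "\<And>n. left_shift (X (Suc n)) = X n"
    "\<And>n. u (X n) = u (X (Suc n)) - b (X (Suc n))" by metis
  have shift: "(left_shift ^^ k) (X (j + k)) = X j" for j k
    by (induction k) (auto simp: funpow_swap1 X(3))
  have sums: "S k (X (j + k)) = u (X (j + k)) - u (X j)" for j k
  proof (induction k)
    case (Suc k)
    then show ?case using X(4)[of "j + k"] by (simp add: birkhoff_sum_Suc_shift X(3))
  qed simp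
  obtain \<zeta> where \<zeta>: "\<zeta> \<in> \<Sigma>" "\<And>n. infinite {i. agree n (X i) \<zeta>}"
    using sft_cluster_point[of X] X(1) by metis
  have near: "\<exists>n. \<forall>y\<in>\<Sigma>. agree n y \<zeta> \<longrightarrow> \<bar>w y - w \<zeta>\<bar> < \<epsilon>"
    if "continuous_map (seq_top lam \<Sigma>) euclideanreal w" "0 < \<epsilon>" for w \<epsilon>
    using that \<zeta>(1) unfolding continuous_map_seq_top[OF lam]
    by (metis agree_sym abs_minus_commute)
  have "v x - u x \<le> v \<zeta> - u \<zeta>"
  proof (rule field_le_epsilon)
    fix e :: real assume "0 < e"
    obtain n where n: "\<And>y. y \<in> \<Sigma> \<Longrightarrow> agree n y \<zeta> \<Longrightarrow> \<bar>u y - u \<zeta>\<bar> < e / 2"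
      using near[OF u(2) half_gt_zero[OF \<open>0 < e\<close>]] by blast
    obtain n' where n': "\<And>y. y \<in> \<Sigma> \<Longrightarrow> agree n' y \<zeta> \<Longrightarrow> \<bar>v y - v \<zeta>\<bar> < e / 2"
      using near[OF v(2) half_gt_zero[OF \<open>0 < e\<close>]] by blast
    obtain i where i: "agree (max n n') (X i) \<zeta>"
      using infinite_imp_nonempty[OF \<zeta>(2)[of "max n n'"]] by auto
    have "\<bar>u (X i) - u \<zeta>\<bar> < e / 2" "\<bar>v (X i) - v \<zeta>\<bar> < e / 2"
      using n[OF X(1)[of i]] n'[OF X(1)[of i]] agree_mono[OF i, of n] agree_mono[OF i, of n'] by simp_all
    moreover have "v x - u x \<le> v (X i) - u (X i)"
      using subaction_path[OF v(1) X(1), of i i] shift[of i 0] sums[of i 0] X(2) by simp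
    ultimately show "v x - u x \<le> v \<zeta> - u \<zeta> + e" by linarith
  qed
  moreover have "\<exists>k\<ge>1. \<exists>z\<in>\<Sigma>. (left_shift ^^ k) z = \<zeta> \<and> agree n z \<zeta> \<and> \<bar>S k z\<bar> < \<epsilon>"
    if "0 < \<epsilon>" for \<epsilon> n
  proof -
    obtain n' where n': "\<And>y. y \<in> \<Sigma> \<Longrightarrow> agree n' y \<zeta> \<Longrightarrow> \<bar>u y - u \<zeta>\<bar> < \<epsilon> / 3"
      using near[OF u(2), of "\<epsilon> / 3"] \<open>0 < \<epsilon>\<close> by auto
    obtain m where m: "1 \<le> m" "max n n' \<le> m" "K * \<rho> ^ m < \<epsilon> / 3"
      using geometric_small[OF \<rho>, of "\<epsilon> / 3" "max n n'" K] \<open>0 < \<epsilon>\<close> by auto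
    obtain i where i: "agree m (X i) \<zeta>" using infinite_imp_nonempty[OF \<zeta>(2)[of m]] by auto
    obtain i' where i': "i < i'" "agree m (X i') \<zeta>"
      using \<zeta>(2)[of m] unfolding infinite_nat_iff_unbounded by blast
    \<comment> \<open>The orbit visits the cylinder of \<open>\<zeta>\<close> of length \<open>m\<close> at times \<open>i\<close> and \<open>i'\<close>; the segment between them is the return.\<close>
    define k where "k = i' - i"
    have k: "1 \<le> k" "i' = i + k" using i' by (auto simp: k_def)
    have sh: "(left_shift ^^ k) (X i') = X i" using shift k by simp
    note tr = transplant[OF X(1)[of i'] \<zeta>(1), of m k, unfolded sh, OF i m(1)]
    have "\<bar>u (X i) - u \<zeta>\<bar> < \<epsilon> / 3" "\<bar>u (X i') - u \<zeta>\<bar> < \<epsilon> / 3"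
      using n' X(1) i i'(2) m(2) agree_mono by (meson max.boundedE)+
    moreover have "S k (X i') = u (X i') - u (X i)" using sums k by simp
    ultimately have "\<bar>S k (graft k (X i') \<zeta>)\<bar> < \<epsilon>" using tr(3) m(3) by linarith
    moreover have "agree n (graft k (X i') \<zeta>) \<zeta>"
    proof (rule agree_trans)
      show "agree n (graft k (X i') \<zeta>) (X i')" using tr(2) by (rule agree_mono) (use m in simp)
      show "agree n (X i') \<zeta>" using i'(2) by (rule agree_mono) (use m in simp)
    qed
    ultimately show ?thesis using k(1) tr(1) funpow_left_shift_graft[of k "X i'" \<zeta>] by blast
  qed
  ultimately have "v x - u x \<le> v \<zeta> - u \<zeta>" "\<zeta> \<in> \<Omega>" using \<zeta>(1) unfolding \<Omega>_def by blast+
  then show ?thesis using that by blast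
qed

lemma \<Omega>_nonempty: "\<Omega> \<noteq> {}"
proof -
  obtain u where u: "calibrated u" "lipschitz K u" using calibrated_exists .
  obtain x where "x \<in> \<Sigma>" using nonempty by blast
  then show ?thesis
    using compare_at_\<Omega>[OF u(1) lipschitz_continuous[OF u(2)] calibrated_subaction[OF u(1)]
        lipschitz_continuous[OF u(2)]] by blast
qed

text \<open>
  From a point \<open>z\<close> near \<open>x \<in> \<Omega>\<close> one can follow a path that returns from \<open>x\<close> to itself at almost no
  cost. A single return may be short, and then its end is hardly closer to \<open>x\<close> than \<open>z\<close> is; but every
  return gains at least one symbol. The transplantation errors of successive returns are therefore
  at most \<open>K * \<rho>\<^sup>n\<close>, \<open>K * \<rho>\<^sup>n\<^sup>+\<^sup>1\<close>, and so on, a geometric series whose partial sums appear in the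
  bound.
\<close>

lemma long_return:
  assumes x: "x \<in> \<Omega>" and z: "z \<in> \<Sigma>" "agree n z x" "1 \<le> n" and \<epsilon>: "0 < \<epsilon>"
  shows "\<exists>k w. m \<le> k \<and> w \<in> \<Sigma> \<and> (left_shift ^^ k) w = z \<and> agree (n + m) w x \<and>
    - S k w \<le> K / (1 - \<rho>) * \<rho> ^ n * (1 - \<rho> ^ m) + \<epsilon>"
  using \<epsilon>
proof (induction m arbitrary: \<epsilon>)
  case 0
  then show ?case using z by (intro exI[of _ 0] exI[of _ z]) auto
next
  case (Suc m)
  let ?c = "K / (1 - \<rho>) * \<rho> ^ n"
  obtain k w where w: "m \<le> k" "w \<in> \<Sigma>" "(left_shift ^^ k) w = z" "agree (n + m) w x"
      "- S k w \<le> ?c * (1 - \<rho> ^ m) + \<epsilon> / 2"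
    using Suc.IH[of "\<epsilon> / 2"] Suc.prems by auto
  obtain l y where y: "1 \<le> l" "y \<in> \<Sigma>" "(left_shift ^^ l) y = x" "agree (n + Suc m) y x" "\<bar>S l y\<bar> < \<epsilon> / 2"
    using \<Omega>_return[OF x half_gt_zero[OF Suc.prems], of "n + Suc m"] by blast
  have nm: "1 \<le> n + m" using z(3) by simp
  note tr = transplant[OF y(2) w(2), of "n + m" l, unfolded y(3), OF agree_sym[OF w(4)] nm]
  let ?w = "graft l y w"
  have "K * \<rho> ^ (n + m) = ?c * \<rho> ^ m * (1 - \<rho>)"
    using \<rho> by (simp add: power_add field_simps)
  moreover have "c * (1 - \<rho> ^ m) + c * \<rho> ^ m * (1 - \<rho>) = c * (1 - \<rho> ^ Suc m)" for c
    by (simp add: algebra_simps)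
  ultimately have "?c * (1 - \<rho> ^ m) + K * \<rho> ^ (n + m) = ?c * (1 - \<rho> ^ Suc m)" by metis
  moreover have "S (l + k) ?w = S l ?w + S k w" by (simp add: birkhoff_sum_add)
  ultimately have "- S (l + k) ?w \<le> ?c * (1 - \<rho> ^ Suc m) + \<epsilon>" using tr(3) y(5) w(5) by linarith
  moreover have "(left_shift ^^ (l + k)) ?w = z"
    using w(3) by (simp only: add.commute[of l k] funpow_add comp_apply funpow_left_shift_graft)
  moreover have "agree (n + Suc m) ?w x"
    using agree_trans[OF agree_mono[OF tr(2)] y(4)] y(1) by simp
  ultimately show ?case using tr(1) w(1) y(1) by (intro exI[of _ "l + k"] exI[of _ ?w]) auto
qed

text \<open>
  Around an almost free return to \<open>x\<close> the values of a sub-action can hardly change, so every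
  step of the return, in particular the first, is almost optimal.
\<close>

lemma subaction_T_eq_on_\<Omega>:
  assumes v: "subaction v" "continuous_map (seq_top lam \<Sigma>) euclideanreal v" and x: "x \<in> \<Omega>"
  shows "T v x = v x"
proof (rule antisym)
  have x\<Sigma>: "x \<in> \<Sigma>" using x \<Omega>_subset by blast
  show "v x \<le> T v x" using subaction_T_ge[OF v(1) x\<Sigma>] .
  show "T v x \<le> v x"
  proof (rule field_le_epsilon)
    fix e :: real assume e: "0 < e"
    obtain n where n: "\<And>y. y \<in> \<Sigma> \<Longrightarrow> agree n x y \<Longrightarrow> \<bar>v x - v y\<bar> < e / 2"
      using v(2) x\<Sigma> e unfolding continuous_map_seq_top[OF lam] by (metis half_gt_zero)
    obtain k z where z: "1 \<le> k" "z \<in> \<Sigma>" "(left_shift ^^ k) z = x" "agree n z x" "\<bar>S k z\<bar> < e / 2"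
      using \<Omega>_return[OF x half_gt_zero[OF e], of n] by blast
    obtain j where j: "k = Suc j" using z(1) by (cases k) auto
    have "T v x \<le> (T ^^ j) (T v) x"
      using subaction_T_iter_ge[OF subaction_T[OF v(1)] x\<Sigma>] .
    also have "\<dots> = (T ^^ k) v x" unfolding j by (simp add: funpow_swap1)
    also have "\<dots> \<le> v z - S k z" using T_iter_le[OF z(2), of k v] z(3) by simp
    finally show "T v x \<le> v x + e" using n[OF z(2) agree_sym[OF z(4)]] z(5) by linarith
  qed
qed

section \<open>Extending admissible functions\<close>

text \<open>
  The inequality between \<open>f\<close> and the Mane potential, unfolded: \<open>c\<close> is any upper bound of
  \<open>S\<^sub>A x x'\<close>, witnessed by paths from \<open>x'\<close> that end arbitrarily near \<open>x\<close>.
\<close>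

definition admissible :: "((nat \<Rightarrow> nat) \<Rightarrow> real) \<Rightarrow> bool"
  where "admissible f \<longleftrightarrow> (\<forall>x\<in>\<Omega>. \<forall>x'\<in>\<Omega>. \<forall>c.
    (\<forall>\<epsilon>>0. \<forall>n. \<exists>k\<ge>1. \<exists>z\<in>\<Sigma>. (left_shift ^^ k) z = x' \<and> agree n z x \<and> - S k z < c + \<epsilon>)
      \<longrightarrow> f x' - f x \<le> c)"

text \<open>
  The path \<open>z\<close> ends near \<open>x\<close> but not arbitrarily near; \<open>long_return\<close> continues it towards \<open>x\<close>.
\<close>

lemma admissible_path:
  assumes f: "admissible f" and x: "x \<in> \<Omega>" "x' \<in> \<Omega>"
    and z: "z \<in> \<Sigma>" "(left_shift ^^ k) z = x'" "agree n z x" "1 \<le> n"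
  shows "f x' - f x \<le> - S k z + K / (1 - \<rho>) * \<rho> ^ n"
proof (rule f[unfolded admissible_def, rule_format, OF x])
  fix \<epsilon> m assume \<epsilon>: "(0::real) < \<epsilon>"
  let ?c = "K / (1 - \<rho>) * \<rho> ^ n"
  obtain l w where w: "Suc m \<le> l" "w \<in> \<Sigma>" "(left_shift ^^ l) w = z" "agree (n + Suc m) w x"
      "- S l w \<le> ?c * (1 - \<rho> ^ Suc m) + \<epsilon> / 2"
    using long_return[OF x(1) z(1,3,4) half_gt_zero[OF \<epsilon>], of "Suc m"] by blast
  have "?c * (1 - \<rho> ^ Suc m) \<le> ?c * 1"
    using K_nonneg \<rho> by (intro mult_left_mono) auto
  moreover have "S (l + k) w = S l w + S k z" using w(3) by (simp add: birkhoff_sum_add)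
  ultimately have "- S (l + k) w < - S k z + ?c + \<epsilon>" using w(5) \<epsilon> by linarith
  moreover have "(left_shift ^^ (l + k)) w = x'"
    using w(3) z(2) by (simp only: add.commute[of l k] funpow_add comp_apply)
  moreover have "agree m w x" using w(4) by (rule agree_mono) simp
  ultimately show "\<exists>k'\<ge>1. \<exists>w\<in>\<Sigma>. (left_shift ^^ k') w = x' \<and> agree m w x \<and>
      - S k' w < - S k z + ?c + \<epsilon>"
    using w(1,2) by (intro exI[of _ "l + k"]) auto
qed

lemma admissible_bounded:
  assumes f: "admissible f"
  obtains F where "0 \<le> F" "\<And>x. x \<in> \<Omega> \<Longrightarrow> \<bar>f x\<bar> \<le> F"
proof -
  define I where "I = (\<lambda>x::nat \<Rightarrow> nat. x 0) ` \<Omega>"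
  have "I \<subseteq> {1..r}" using \<Omega>_subset by (auto simp: I_def sft_def)
  then have fin: "finite I" by (rule finite_subset) auto
  have "\<forall>i\<in>I. \<exists>e. e \<in> \<Omega> \<and> e 0 = i" by (auto simp: I_def)
  then obtain e where e: "\<And>i. i \<in> I \<Longrightarrow> e i \<in> \<Omega> \<and> e i 0 = i" by metis
  let ?F = "Max ((\<lambda>i. \<bar>f (e i)\<bar>) ` I) + K / (1 - \<rho>)"
  have bound: "\<bar>f x\<bar> \<le> ?F" if x: "x \<in> \<Omega>" for x
  proof -
    have i: "x 0 \<in> I" using x by (simp add: I_def)
    have one: "f y' - f y \<le> K / (1 - \<rho>) * \<rho> ^ 1" if "y \<in> \<Omega>" "y' \<in> \<Omega>" "y' 0 = y 0" for y y'
      using admissible_path[OF f that(1,2), of y' 0 1] that \<Omega>_subset by auto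
    have "\<bar>f x - f (e (x 0))\<bar> \<le> K / (1 - \<rho>) * \<rho> ^ 1"
      using one[of x "e (x 0)"] one[of "e (x 0)" x] e[OF i] x by (simp add: abs_le_iff)
    also have "\<dots> \<le> K / (1 - \<rho>)" using K_nonneg \<rho> by (intro mult_left_le) auto
    finally have "\<bar>f x - f (e (x 0))\<bar> \<le> K / (1 - \<rho>)" .
    moreover have "\<bar>f (e (x 0))\<bar> \<le> Max ((\<lambda>i. \<bar>f (e i)\<bar>) ` I)"
      using fin i by (intro Max_ge) auto
    ultimately show ?thesis by linarith
  qed
  moreover have "0 \<le> ?F" using bound \<Omega>_nonempty by (meson abs_ge_zero ex_in_conv order_trans)
  ultimately show ?thesis using that by blast
qed

text \<open>
  The extension \<open>\<phi>\<close> penalises the distance from \<open>\<Omega>\<close> strongly enough that no path can profit from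
  leaving it. Paths that end in the cylinder of the first symbol of \<open>x\<close> are controlled by
  \<open>admissible_path\<close>, all others by the uniform bounds of \<open>f\<close> and of the Birkhoff sums; this dictates
  \<open>K'\<close>.
\<close>

lemma admissible_extends:
  assumes f: "admissible f"
  obtains u K' where "calibrated u" "lipschitz K' u" "\<And>x. x \<in> \<Omega> \<Longrightarrow> u x = f x"
proof -
  obtain F where F: "0 \<le> F" "\<And>x. x \<in> \<Omega> \<Longrightarrow> \<bar>f x\<bar> \<le> F" using admissible_bounded[OF f] by metis
  interpret d: Metric_space UNIV "seq_dist \<rho>" by (rule Metric_space_seq_dist[OF \<rho>])
  define K' where "K' = max (K / (1 - \<rho>)) (2 * F + D)"
  have K': "K / (1 - \<rho>) \<le> K'" "2 * F + D \<le> K'" by (simp_all add: K'_def)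
  have "K \<le> K / (1 - \<rho>)" using K_nonneg \<rho> by (simp add: field_simps mult_left_le)
  then have K'_ge: "K \<le> K'" "0 \<le> K'" using K' K_nonneg by linarith+
  define \<phi> where "\<phi> z = (INF x\<in>\<Omega>. f x + K' * seq_dist \<rho> z x)" for z
  have lower: "- F \<le> f x + K' * seq_dist \<rho> z x" if "x \<in> \<Omega>" for x z
    using F(2)[OF that] mult_nonneg_nonneg[OF K'_ge(2) d.nonneg[of z x]] by linarith
  then have bdd: "bdd_below ((\<lambda>x. f x + K' * seq_dist \<rho> z x) ` \<Omega>)" for z
    by (intro bdd_belowI[of _ "- F"]) auto
  have \<phi>_le: "\<phi> z \<le> f x + K' * seq_dist \<rho> z x" if "x \<in> \<Omega>" for x z
    unfolding \<phi>_def using bdd that by (intro cINF_lower)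
  have \<phi>_bounded: "\<bar>\<phi> z\<bar> \<le> F + K'" for z
  proof -
    obtain x where x: "x \<in> \<Omega>" using \<Omega>_nonempty by blast
    have "seq_dist \<rho> z x \<le> 1" using agree_le_seq_dist[OF \<rho>, of z x 0] by (simp add: agree_def)
    then have "K' * seq_dist \<rho> z x \<le> K'" using K'_ge(2) by (simp add: mult_left_le)
    then have "\<phi> z \<le> F + K'" using \<phi>_le[OF x, of z] F(2)[OF x] by linarith
    moreover have "- F \<le> \<phi> z" unfolding \<phi>_def using \<Omega>_nonempty lower by (intro cINF_greatest) auto
    ultimately show ?thesis using K'_ge(2) by linarith
  qed
  have \<phi>_lipschitz: "lipschitz K' \<phi>"
    unfolding lipschitz_def
  proof (intro ballI allI impI)
    fix z z' n assume "agree n z z'"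
    then have zz': "seq_dist \<rho> z z' \<le> \<rho> ^ n" using agree_le_seq_dist[OF \<rho>] by blast
    have "\<bar>(f x + K' * seq_dist \<rho> z x) - (f x + K' * seq_dist \<rho> z' x)\<bar> \<le> K' * \<rho> ^ n" for x
    proof -
      have "\<bar>seq_dist \<rho> z x - seq_dist \<rho> z' x\<bar> \<le> \<rho> ^ n"
        using d.triangle[of z z' x] d.triangle[of z' z x] d.commute[of z z'] zz' by (simp add: abs_le_iff)
      then have "K' * \<bar>seq_dist \<rho> z x - seq_dist \<rho> z' x\<bar> \<le> K' * \<rho> ^ n"
        using K'_ge(2) by (rule mult_left_mono)
      then show ?thesis using K'_ge(2) by (simp add: abs_mult flip: right_diff_distrib)
    qed
    then show "\<bar>\<phi> z - \<phi> z'\<bar> \<le> K' * \<rho> ^ n"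
      unfolding \<phi>_def using \<Omega>_nonempty bdd by (intro abs_INF_diff_le) auto
  qed
  define g where "g = subaction_envelope \<phi>"
  define u where "u = calibrated_envelope \<phi>"
  note facts = \<phi>_lipschitz K'_ge(1) \<phi>_bounded
  have g_f: "g x = f x" if x: "x \<in> \<Omega>" for x
  proof (rule antisym)
    have x\<Sigma>: "x \<in> \<Sigma>" using x \<Omega>_subset by blast
    have "g x \<le> \<phi> x" unfolding g_def using subaction_envelope_le[OF facts x\<Sigma>, of 0] by simp
    also have "\<dots> \<le> f x" using \<phi>_le[OF x, of x] by simp
    finally show "g x \<le> f x" .
    have "f x \<le> (T ^^ n) \<phi> x" for n
    proof -
      obtain z where z: "z \<in> \<Sigma>" "(left_shift ^^ n) z = x" "(T ^^ n) \<phi> x = \<phi> z - S n z"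
        using T_iter_attained[OF x\<Sigma>] by blast
      have "f x + S n z \<le> f y + K' * seq_dist \<rho> z y" if y: "y \<in> \<Omega>" for y
      proof -
        consider "z 0 \<noteq> y 0" | "z = y" | "z 0 = y 0" "z \<noteq> y" by blast
        then show ?thesis
        proof cases
          case 1
          then have "(LEAST j. z j \<noteq> y j) = 0" by (intro Least_equality) auto
          then have "seq_dist \<rho> z y = 1" using 1 by (auto simp: seq_dist_def)
          then show ?thesis using F(2)[OF x] F(2)[OF y] S_le[OF z(1), of n] K'(2) by simp
        next
          case 2
          \<comment> \<open>The path ends exactly at \<open>y\<close>, so its end agrees with \<open>y\<close> for every number \<open>m\<close> of symbols.\<close>
          have "f x - f y + S n z \<le> 0"
          proof (rule field_le_epsilon)
            fix e :: real assume "0 < e"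
            then obtain m where m: "1 \<le> m" "K / (1 - \<rho>) * \<rho> ^ m < e" using geometric_small[OF \<rho>] by metis
            show "f x - f y + S n z \<le> 0 + e"
              using admissible_path[OF f y x z(1,2), of m] m 2 by simp
          qed
          then show ?thesis using 2 by simp
        next
          case 3
          define m where "m = (LEAST j. z j \<noteq> y j)"
          have d: "seq_dist \<rho> z y = \<rho> ^ m" using 3 by (simp add: seq_dist_def m_def)
          then have ag: "agree m z y" using agree_le_seq_dist[OF \<rho>, of z y m] by simp
          have "z m \<noteq> y m" unfolding m_def by (rule LeastI_ex) (use 3 in auto)
          then have m1: "1 \<le> m" using 3 by (cases m) auto
          have "K / (1 - \<rho>) * \<rho> ^ m \<le> K' * \<rho> ^ m" using K'(1) \<rho> by (intro mult_right_mono) auto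
          then show ?thesis using admissible_path[OF f y x z(1,2) ag m1] unfolding d by linarith
        qed
      qed
      then have "f x + S n z \<le> \<phi> z" unfolding \<phi>_def using \<Omega>_nonempty by (intro cINF_greatest) auto
      then show ?thesis using z(3) by linarith
    qed
    then show "f x \<le> g x" unfolding g_def by (rule subaction_envelope_greatest[OF facts])
  qed
  have "(T ^^ n) g x = f x" if x: "x \<in> \<Omega>" for n x
  proof (induction n)
    case (Suc n)
    have "subaction ((T ^^ n) g)" unfolding g_def by (intro subaction_T_iter subaction_envelope_subaction[OF facts])
    moreover have "lipschitz K' ((T ^^ n) g)"
      unfolding g_def by (intro T_iter_lipschitz[OF subaction_envelope_lipschitz[OF facts]] K'_ge(1))
    ultimately show ?case using subaction_T_eq_on_\<Omega>[OF _ lipschitz_continuous x] Suc.IH by simp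
  qed (simp add: g_f x)
  then have "u x = f x" if "x \<in> \<Omega>" for x
    using that unfolding u_def calibrated_envelope_def[OF facts] g_def[symmetric] by simp
  moreover have "calibrated u" "lipschitz K' u"
    unfolding u_def by (rule calibrated_envelope_calibrated[OF facts] calibrated_envelope_lipschitz[OF facts])+
  ultimately show ?thesis using that by blast
qed

end

section \<open>Reduction to the one-sided shift\<close>

text \<open>
  A Hoelder condition with exponent \<open>\<theta>\<close> in the metric with base \<open>lam\<close> is a Lipschitz condition in
  the metric with base \<open>\<rho> = lam powr \<theta>\<close>.
\<close>

locale holder_potential = transitive_sft +
  fixes A :: "(nat \<Rightarrow> nat) \<times> (nat \<Rightarrow> nat) \<Rightarrow> real" and \<rho> C :: real
  assumes \<rho>: "0 < \<rho>" "\<rho> < 1"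
    and C_nonneg: "0 \<le> C"
    and A_holder: "\<And>n p q. p \<in> sft_ext r M \<Longrightarrow> q \<in> sft_ext r M \<Longrightarrow>
      agree n (fst p) (fst q) \<Longrightarrow> agree n (snd p) (snd q) \<Longrightarrow> \<bar>A p - A q\<bar> \<le> C * \<rho> ^ n"
begin

abbreviation E where "E \<equiv> sft_ext r M"
abbreviation \<beta> where "\<beta> \<equiv> beta lam r M A"

lemma tau_surj:
  assumes "z \<in> \<Sigma>"
  obtains y where "(y, left_shift z) \<in> E" "y 0 = z 0"
  using dual_exists[OF assms] sft_ext_iff[OF assms] by metis

definition A_sup :: real where "A_sup = (SUP p\<in>E. \<bar>A p\<bar>)"

lemma A_bounded: "p \<in> E \<Longrightarrow> \<bar>A p\<bar> \<le> A_sup"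
proof -
  assume p: "p \<in> E"
  have "\<bar>A q\<bar> \<le> \<bar>A p\<bar> + C" if "q \<in> E" for q
    using A_holder[OF p that, of 0] by (simp add: agree_def)
  then have "bdd_above ((\<lambda>p. \<bar>A p\<bar>) ` E)" by (intro bdd_aboveI[of _ "\<bar>A p\<bar> + C"]) auto
  then show "\<bar>A p\<bar> \<le> A_sup" unfolding A_sup_def using p by (rule cSUP_upper2) auto
qed

definition is_maximiser :: "(nat \<Rightarrow> nat) \<Rightarrow> (nat \<Rightarrow> nat) \<Rightarrow> bool"
  where "is_maximiser z y \<longleftrightarrow> (y, left_shift z) \<in> E \<and> y 0 = z 0 \<and>
    (\<forall>y'. (y', left_shift z) \<in> E \<and> y' 0 = z 0 \<longrightarrow> A (y', left_shift z) \<le> A (y, left_shift z))"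

text \<open>
  The fibre over a symbol is compact, so the supremum over the dual points is attained at a cluster
  point of a maximising sequence.
\<close>

lemma maximiser_exists:
  assumes z: "z \<in> \<Sigma>"
  shows "\<exists>y. is_maximiser z y"
proof -
  let ?Y = "{y. (y, left_shift z) \<in> E \<and> y 0 = z 0}"
  let ?f = "\<lambda>y. A (y, left_shift z)"
  have ne: "?Y \<noteq> {}" using tau_surj[OF z] by auto
  have bdd: "bdd_above (?f ` ?Y)"
    using A_bounded by (intro bdd_aboveI[of _ A_sup]) (auto simp: abs_le_iff)
  define s where "s = (SUP y\<in>?Y. ?f y)"
  have upper: "?f y \<le> s" if "y \<in> ?Y" for y unfolding s_def using that bdd by (rule cSUP_upper)
  have "\<exists>y\<in>?Y. s - 1 / real (Suc i) < ?f y" for i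
    using less_cSUP_iff[OF ne bdd, of "s - 1 / real (Suc i)"] by (simp add: s_def)
  then have "\<forall>i. \<exists>y. y \<in> ?Y \<and> s - 1 / real (Suc i) < ?f y" by blast
  then have "\<exists>X. \<forall>i. X i \<in> ?Y \<and> s - 1 / real (Suc i) < ?f (X i)" by (rule choice)
  then obtain X where X: "\<And>i. X i \<in> ?Y" "\<And>i. s - 1 / real (Suc i) < ?f (X i)" by blast
  have "X i \<in> sft_dual r M" for i using X(1)[of i] by (auto simp: sft_ext_def)
  then obtain \<zeta> where \<zeta>: "\<zeta> \<in> sft_dual r M" "\<And>n. infinite {i. agree n (X i) \<zeta>}"
    using sft_dual_cluster_point by metis
  obtain i where "agree (Suc 0) (X i) \<zeta>" using infinite_imp_nonempty[OF \<zeta>(2)[of "Suc 0"]] by auto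
  then have \<zeta>0: "\<zeta> 0 = z 0" using X(1)[of i] by simp
  have \<zeta>E: "(\<zeta>, left_shift z) \<in> E" using sft_ext_iff[of z r M \<zeta>, OF z \<zeta>0] \<zeta>(1) by simp
  have "s \<le> ?f \<zeta>"
  proof (rule field_le_epsilon)
    fix e :: real assume e: "0 < e"
    obtain j where j: "1 / real (Suc j) < e / 2" using nat_approx_posE[OF half_gt_zero[OF e]] by metis
    obtain n where n: "C * \<rho> ^ n < e / 2" using geometric_small[OF \<rho> half_gt_zero[OF e]] by metis
    obtain i where i: "j < i" "agree n (X i) \<zeta>"
      using \<zeta>(2)[of n] unfolding infinite_nat_iff_unbounded by blast
    have "1 / real (Suc i) \<le> 1 / real (Suc j)" using i(1) by (intro divide_left_mono) auto
    moreover have "\<bar>?f (X i) - ?f \<zeta>\<bar> \<le> C * \<rho> ^ n" using X(1)[of i] \<zeta>E i(2) by (intro A_holder) auto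
    ultimately show "s \<le> ?f \<zeta> + e" using X(2)[of i] j n by linarith
  qed
  then show ?thesis using upper \<zeta>E \<zeta>0 unfolding is_maximiser_def by (intro exI[of _ \<zeta>]) force
qed

definition Y :: "(nat \<Rightarrow> nat) \<Rightarrow> nat \<Rightarrow> nat" where "Y z = (SOME y. is_maximiser z y)"

text \<open>
  The best weight, relative to \<open>\<beta>\<close>, of a step of a path that ends at \<open>z\<close>.
\<close>

definition b :: "(nat \<Rightarrow> nat) \<Rightarrow> real" where "b z = A (Y z, left_shift z) - \<beta>"

lemma Y_maximiser: "z \<in> \<Sigma> \<Longrightarrow> is_maximiser z (Y z)"
  unfolding Y_def using maximiser_exists by (rule someI_ex)

lemma Y_in: "z \<in> \<Sigma> \<Longrightarrow> (Y z, left_shift z) \<in> E" and Y_0: "z \<in> \<Sigma> \<Longrightarrow> Y z 0 = z 0"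
  using Y_maximiser by (auto simp: is_maximiser_def)

lemma A_le_b: "p \<in> E \<Longrightarrow> A p - \<beta> \<le> b (tau p)"
  using Y_maximiser[OF tau_in_sft, of p] unfolding is_maximiser_def b_def
  by (metis diff_right_mono left_shift_tau prod.collapse tau_0)

text \<open>
  A dual point admitted over \<open>z\<close> is admitted over every \<open>z'\<close> with the same first symbol, so the maxima
  over \<open>z\<close> and \<open>z'\<close> differ no more than the values of \<open>A\<close> do.
\<close>

sublocale lipschitz_potential r M lam b \<rho> C "A_sup + \<bar>\<beta>\<bar>"
proof
  show "\<bar>b z\<bar> \<le> A_sup + \<bar>\<beta>\<bar>" if "z \<in> \<Sigma>" for z
    using A_bounded[OF Y_in[OF that]] unfolding b_def by linarith
next
  have *: "b z - b z' \<le> C * \<rho> ^ n" if z: "z \<in> \<Sigma>" "z' \<in> \<Sigma>" "agree (Suc n) z z'" for n z z'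
  proof -
    have ag: "z 0 = z' 0" "agree n (left_shift z) (left_shift z')" using z(3) by (auto simp: agree_Suc_iff)
    have y: "Y z 0 = z' 0" using Y_0[OF z(1)] ag by simp
    have e: "(Y z, left_shift z') \<in> E" using Y_in[OF z(1)] sft_ext_iff[of z' r M "Y z", OF z(2) y]
      by (simp add: sft_ext_def)
    have "A (Y z, left_shift z') - \<beta> \<le> b z'" using A_le_b[OF e] tau_eq[of "Y z" z', OF y] by simp
    moreover have "\<bar>A (Y z, left_shift z) - A (Y z, left_shift z')\<bar> \<le> C * \<rho> ^ n"
      using Y_in[OF z(1)] e ag by (intro A_holder) auto
    ultimately show ?thesis unfolding b_def[of z] by linarith
  qed
  show "\<bar>b z - b z'\<bar> \<le> C * \<rho> ^ n" if "z \<in> \<Sigma>" "z' \<in> \<Sigma>" "agree (Suc n) z z'" for n z z'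
    using *[OF that] *[OF that(2,1) agree_sym[OF that(3)]] by linarith
qed (use \<rho> C_nonneg in auto)

section \<open>Holonomic probabilities and normalisation\<close>

lemma continuous_measurable:
  assumes "\<mu> \<in> borel_prob X" "continuous_map X euclideanreal h"
  shows "h \<in> borel_measurable \<mu>"
proof (rule borel_measurableI)
  fix U :: "real set" assume "open U"
  then have "openin X {p \<in> topspace X. h p \<in> U}"
    using assms(2) by (auto simp: continuous_map_def open_openin[symmetric] )
  moreover have "h -` U \<inter> space \<mu> = {p \<in> topspace X. h p \<in> U}"
    using assms(1) by (auto simp: borel_prob_def)
  ultimately show "h -` U \<inter> space \<mu> \<in> sets \<mu>"
    using assms(1) by (auto simp: borel_prob_def intro: sigma_sets.Basic)
qed

lemma topspace_E: "topspace (ext_top lam E) = E"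
  using Metric_space.topspace_mtopology[OF Metric_space_ext_dist[OF lam]] .

lemma A_continuous: "continuous_map (ext_top lam E) euclideanreal A"
  unfolding continuous_map_ext_top[OF lam]
proof (intro ballI allI impI)
  fix p \<epsilon> assume p: "p \<in> E" "(0::real) < \<epsilon>"
  obtain n where n: "C * \<rho> ^ n < \<epsilon>" using geometric_small[OF \<rho> p(2)] by metis
  show "\<exists>n. \<forall>q\<in>E. agree n (fst p) (fst q) \<and> agree n (snd p) (snd q) \<longrightarrow> \<bar>A p - A q\<bar> < \<epsilon>"
    using A_holder[OF p(1), of _ n] n by (intro exI[of _ n]) force
qed

lemma agree_tau:
  assumes "agree n (fst p) (fst q)" "agree n (snd p) (snd q)"
  shows "agree n (tau p) (tau q)"
  using assms by (auto simp: agree_def tau_def split: prod.splits nat.splits)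

lemma continuous_tau_snd:
  assumes w: "continuous_map (seq_top lam \<Sigma>) euclideanreal w"
  shows "continuous_map (ext_top lam E) euclideanreal (\<lambda>p. w (tau p))"
    and "continuous_map (ext_top lam E) euclideanreal (\<lambda>p. w (snd p))"
proof -
  have w': "\<exists>n. \<forall>y\<in>\<Sigma>. agree n x y \<longrightarrow> \<bar>w x - w y\<bar> < \<epsilon>" if "x \<in> \<Sigma>" "0 < \<epsilon>" for x \<epsilon>
    using w that unfolding continuous_map_seq_top[OF lam] by blast
  show "continuous_map (ext_top lam E) euclideanreal (\<lambda>p. w (tau p))"
    unfolding continuous_map_ext_top[OF lam]
  proof (intro ballI allI impI)
    fix p \<epsilon> assume p: "p \<in> E" "(0::real) < \<epsilon>"
    obtain n where "\<forall>y\<in>\<Sigma>. agree n (tau p) y \<longrightarrow> \<bar>w (tau p) - w y\<bar> < \<epsilon>"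
      using w'[OF tau_in_sft[OF p(1)] p(2)] by blast
    then show "\<exists>n. \<forall>q\<in>E. agree n (fst p) (fst q) \<and> agree n (snd p) (snd q) \<longrightarrow> \<bar>w (tau p) - w (tau q)\<bar> < \<epsilon>"
      using agree_tau tau_in_sft by (intro exI[of _ n]) blast
  qed
  show "continuous_map (ext_top lam E) euclideanreal (\<lambda>p. w (snd p))"
    unfolding continuous_map_ext_top[OF lam]
  proof (intro ballI allI impI)
    fix p \<epsilon> assume p: "p \<in> E" "(0::real) < \<epsilon>"
    obtain n where "\<forall>y\<in>\<Sigma>. agree n (snd p) y \<longrightarrow> \<bar>w (snd p) - w y\<bar> < \<epsilon>"
      using w'[OF snd_in_sft[OF p(1)] p(2)] by blast
    then show "\<exists>n. \<forall>q\<in>E. agree n (fst p) (fst q) \<and> agree n (snd p) (snd q) \<longrightarrow> \<bar>w (snd p) - w (snd q)\<bar> < \<epsilon>"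
      using snd_in_sft by (intro exI[of _ n]) blast
  qed
qed

lemma restrict_cont_funs:
  assumes "continuous_map (seq_top lam \<Sigma>) euclideanreal w" "X \<subseteq> \<Sigma>"
  shows "restrict w X \<in> cont_funs (seq_top lam X)"
proof -
  have "topspace (seq_top lam X) = X"
    using Metric_space.topspace_mtopology[OF Metric_space_seq_dist[OF lam]] .
  moreover have "continuous_map (seq_top lam X) euclideanreal (restrict w X)"
    unfolding continuous_map_seq_top[OF lam]
  proof (intro ballI allI impI)
    fix x \<epsilon> assume x: "x \<in> X" "(0::real) < \<epsilon>"
    then obtain n where "\<forall>y\<in>\<Sigma>. agree n x y \<longrightarrow> \<bar>w x - w y\<bar> < \<epsilon>"
      using assms unfolding continuous_map_seq_top[OF lam] by blast
    then show "\<exists>n. \<forall>y\<in>X. agree n x y \<longrightarrow> \<bar>restrict w X x - restrict w X y\<bar> < \<epsilon>"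
      using x assms(2) by (intro exI[of _ n]) auto
  qed
  ultimately show ?thesis by (simp add: cont_funs_def)
qed

context
  fixes \<mu> assumes \<mu>: "\<mu> \<in> holonomic lam r M"
begin

lemma holonomic_borel_prob: "\<mu> \<in> borel_prob (ext_top lam E)"
  using \<mu> by (simp add: holonomic_def)

lemma holonomic_prob_space: "prob_space \<mu>" and holonomic_space: "space \<mu> = E"
  using holonomic_borel_prob topspace_E by (auto simp: borel_prob_def)

lemma holonomic_integrable:
  assumes "continuous_map (ext_top lam E) euclideanreal h" "\<And>p. p \<in> E \<Longrightarrow> \<bar>h p\<bar> \<le> B"
  shows "integrable \<mu> h"
proof -
  interpret prob_space \<mu> by (rule holonomic_prob_space)
  show ?thesis
    using assms continuous_measurable[OF holonomic_borel_prob assms(1)]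
    by (intro integrable_const_bound[of _ B]) (auto simp: holonomic_space)
qed

lemma holonomic_integrable_A: "integrable \<mu> A"
  using holonomic_integrable A_continuous A_bounded by blast

lemma holonomic_integrable_lift:
  assumes "continuous_map (seq_top lam \<Sigma>) euclideanreal w"
  shows "integrable \<mu> (\<lambda>p. w (tau p))" "integrable \<mu> (\<lambda>p. w (snd p))"
proof -
  obtain B where "\<And>x. x \<in> \<Sigma> \<Longrightarrow> \<bar>w x\<bar> \<le> B" using continuous_bounded[OF assms] by blast
  then show "integrable \<mu> (\<lambda>p. w (tau p))" "integrable \<mu> (\<lambda>p. w (snd p))"
    using holonomic_integrable[OF continuous_tau_snd(1)[OF assms]]
      holonomic_integrable[OF continuous_tau_snd(2)[OF assms]] tau_in_sft snd_in_sft by blast+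
qed

lemma holonomic_integral_eq:
  assumes "continuous_map (seq_top lam \<Sigma>) euclideanreal w"
  shows "(\<integral>p. w (tau p) \<partial>\<mu>) = (\<integral>p. w (snd p) \<partial>\<mu>)"
proof -
  have "(\<integral>p. w (tau p) \<partial>\<mu>) = (\<integral>p. restrict w \<Sigma> (tau p) \<partial>\<mu>)"
    by (intro Bochner_Integration.integral_cong) (auto simp: holonomic_space tau_in_sft)
  also have "\<dots> = (\<integral>p. restrict w \<Sigma> (snd p) \<partial>\<mu>)"
    using \<mu> restrict_cont_funs[OF assms order_refl] by (auto simp: holonomic_def)
  also have "\<dots> = (\<integral>p. w (snd p) \<partial>\<mu>)"
    by (intro Bochner_Integration.integral_cong) (auto simp: holonomic_space snd_in_sft)
  finally show ?thesis .
qed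

lemma holonomic_integral_A_le: "(\<integral>p. A p \<partial>\<mu>) \<le> A_sup"
proof -
  interpret prob_space \<mu> by (rule holonomic_prob_space)
  show ?thesis
    using A_bounded by (intro integral_le_const holonomic_integrable_A) (auto simp: holonomic_space abs_le_iff)
qed

text \<open>
  Since \<open>A p - \<beta> \<le> b (\<tau> p)\<close> and \<open>T\<^sup>n\<^sup>+\<^sup>1 0 (snd p) \<le> T\<^sup>n 0 (\<tau> p) - b (\<tau> p)\<close>, the holonomic condition turns
  the integral of \<open>A - \<beta>\<close> into a difference of consecutive integrals.
\<close>

lemma holonomic_integral_T:
  "real n * ((\<integral>p. A p \<partial>\<mu>) - \<beta>) \<le> - (\<integral>p. (T ^^ n) (\<lambda>_. 0) (snd p) \<partial>\<mu>)"
proof (induction n)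
  case (Suc n)
  interpret prob_space \<mu> by (rule holonomic_prob_space)
  let ?m = "\<lambda>n. (T ^^ n) (\<lambda>_. 0::real)"
  note cont = lipschitz_continuous[OF T_iter_zero_lipschitz]
  note int = holonomic_integrable_lift[OF cont]
  have "(\<integral>p. A p - \<beta> \<partial>\<mu>) \<le> (\<integral>p. ?m n (tau p) - ?m (Suc n) (snd p) \<partial>\<mu>)"
  proof (rule integral_mono)
    fix p assume "p \<in> space \<mu>"
    then have p: "p \<in> E" by (simp add: holonomic_space)
    show "A p - \<beta> \<le> ?m n (tau p) - ?m (Suc n) (snd p)"
      using A_le_b[OF p] T_le[OF tau_in_sft[OF p], of "?m n"] by simp
  qed (use int holonomic_integrable_A in \<open>auto simp del: funpow.simps\<close>)
  also have "\<dots> = (\<integral>p. ?m n (snd p) \<partial>\<mu>) - (\<integral>p. ?m (Suc n) (snd p) \<partial>\<mu>)"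
    using int by (simp del: funpow.simps add: holonomic_integral_eq[OF cont])
  also have "(\<integral>p. A p - \<beta> \<partial>\<mu>) = (\<integral>p. A p \<partial>\<mu>) - \<beta>"
    using holonomic_integrable_A by (simp add: prob_space)
  finally show ?case using Suc.IH by (simp add: algebra_simps del: funpow.simps)
qed simp

end

text \<open>
  The uniform distribution on the pairs \<open>(y\<^sub>j, \<sigma>\<^sup>j\<^sup>+\<^sup>1 p)\<close> with \<open>y\<^sub>j\<close> optimal and \<open>\<tau> (y\<^sub>j, \<sigma>\<^sup>j\<^sup>+\<^sup>1 p) = \<sigma>\<^sup>j p\<close>:
  the map \<open>\<tau>\<close> runs through the periodic orbit backwards, so it permutes the second components.
\<close>

lemma periodic_holonomic:
  assumes p: "p \<in> \<Sigma>" "(left_shift ^^ k) p = p" and k: "1 \<le> k"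
  obtains \<mu> where "\<mu> \<in> holonomic lam r M" "(\<integral>p. A p \<partial>\<mu>) = \<beta> + S k p / real k"
proof -
  let ?s = "\<lambda>j. (left_shift ^^ j) p"
  define g where "g j = (Y (?s j), left_shift (?s j))" for j
  have g: "g j \<in> E" for j unfolding g_def using Y_in p by simp
  define N where "N = sigma E {U. openin (ext_top lam E) U}"
  have openE: "{U. openin (ext_top lam E) U} \<subseteq> Pow E" using openin_subset topspace_E by blast
  have N: "space N = E" "sets N = sigma_sets E {U. openin (ext_top lam E) U}"
    unfolding N_def using openE by (simp_all add: sets_measure_of)
  define P where "P = measure_pmf (pmf_of_set {..<k})"
  have P: "prob_space P" unfolding P_def by (rule prob_space_measure_pmf)
  have gm: "g \<in> measurable P N" unfolding P_def using g N by (auto simp: measurable_def)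
  define \<mu> where "\<mu> = distr P N g"
  have bp: "\<mu> \<in> borel_prob (ext_top lam E)"
    unfolding borel_prob_def topspace_E \<mu>_def using N prob_space.prob_space_distr[OF P gm] by simp
  have int: "(\<integral>p. h p \<partial>\<mu>) = (\<Sum>j<k. h (g j)) / real k"
    if "continuous_map (ext_top lam E) euclideanreal h" for h :: "_ \<Rightarrow> real"
  proof -
    have "h \<in> borel_measurable N" using continuous_measurable[OF bp that] by (simp add: \<mu>_def)
    then have "(\<integral>p. h p \<partial>\<mu>) = (\<integral>j. h (g j) \<partial>P)" unfolding \<mu>_def by (intro integral_distr gm)
    also have "\<dots> = (\<Sum>j<k. h (g j)) / real k"
      unfolding P_def using k by (subst integral_pmf_of_set) (auto simp: lessThan_empty_iff)
    finally show ?thesis .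
  qed
  have tau_g: "tau (g j) = ?s j" for j
    unfolding g_def using Y_0 p by (intro tau_eq) simp
  have "(\<integral>q. f (tau q) \<partial>\<mu>) = (\<integral>q. f (snd q) \<partial>\<mu>)" if "f \<in> cont_funs (seq_top lam \<Sigma>)" for f
  proof -
    have f: "continuous_map (seq_top lam \<Sigma>) euclideanreal f" using that by (simp add: cont_funs_def)
    have "(\<Sum>j<k. f (?s (Suc j))) - (\<Sum>j<k. f (?s j)) = f (?s k) - f (?s 0)"
      unfolding sum_subtractf[symmetric] by (rule sum_lessThan_telescope)
    then have "(\<Sum>j<k. f (tau (g j))) = (\<Sum>j<k. f (snd (g j)))" using p(2) tau_g by (simp add: g_def)
    then show ?thesis using int[OF continuous_tau_snd(1)[OF f]] int[OF continuous_tau_snd(2)[OF f]] by simp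
  qed
  then have "\<mu> \<in> holonomic lam r M" using bp by (simp add: holonomic_def)
  moreover have "(\<Sum>j<k. A (g j)) = S k p + real k * \<beta>"
    by (simp add: g_def birkhoff_sum_def b_def sum_subtractf)
  then have "(\<integral>p. A p \<partial>\<mu>) = \<beta> + S k p / real k" using int[OF A_continuous] k by (simp add: field_simps)
  ultimately show ?thesis using that by blast
qed

lemma holonomic_integrals_bdd_above: "bdd_above ((\<lambda>\<mu>. \<integral>p. A p \<partial>\<mu>) ` holonomic lam r M)"
  using holonomic_integral_A_le by (intro bdd_aboveI[of _ A_sup]) auto

lemma holonomic_nonempty: "holonomic lam r M \<noteq> {}"
proof -
  obtain z where "z \<in> \<Sigma>" using nonempty by blast
  then obtain k p where "1 \<le> k" "p \<in> \<Sigma>" "(left_shift ^^ k) p = p" using closing by metis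
  then show ?thesis using periodic_holonomic by blast
qed

lemma periodic_sum_nonpos:
  assumes "p \<in> \<Sigma>" "(left_shift ^^ k) p = p" "1 \<le> k"
  shows "S k p \<le> 0"
proof -
  obtain \<mu> where \<mu>: "\<mu> \<in> holonomic lam r M" "(\<integral>p. A p \<partial>\<mu>) = \<beta> + S k p / real k"
    using periodic_holonomic[OF assms] .
  have "(\<integral>p. A p \<partial>\<mu>) \<le> \<beta>"
    unfolding beta_def using \<mu>(1) holonomic_integrals_bdd_above by (rule cSUP_upper)
  then show ?thesis using \<mu>(2) assms(3) by (simp add: divide_le_0_iff)
qed

text \<open>
  The upper bound of \<open>T\<^sup>n 0\<close> rests on the definition of \<open>\<beta>\<close> as a least upper bound: a value
  \<open>T\<^sup>n 0 x\<close> above the oscillation bound would make \<open>T\<^sup>n 0\<close> positive everywhere, and the integrals of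
  \<open>A\<close> would stay away from \<open>\<beta>\<close>.
\<close>

lemma normalised: "\<exists>D. normalised_potential r M lam b \<rho> C (A_sup + \<bar>\<beta>\<bar>) D"
proof -
  let ?m = "\<lambda>n. (T ^^ n) (\<lambda>_. 0::real)"
  obtain L where L: "\<And>n z. z \<in> \<Sigma> \<Longrightarrow>
    \<exists>k p. 1 \<le> k \<and> n \<le> k \<and> p \<in> \<Sigma> \<and> (left_shift ^^ k) p = p \<and> k \<le> n + L \<and>
      S n z \<le> S k p + K + real L * (A_sup + \<bar>\<beta>\<bar>)" using closing by blast
  obtain D where D: "\<And>n x x'. x \<in> \<Sigma> \<Longrightarrow> x' \<in> \<Sigma> \<Longrightarrow> ?m n x \<le> ?m n x' + D"
    using T_iter_zero_oscillation by blast
  have "S n z \<le> K + real L * (A_sup + \<bar>\<beta>\<bar>)" if "z \<in> \<Sigma>" for n z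
    using L[OF that, of n] periodic_sum_nonpos by fastforce
  moreover have "?m n x \<le> D" if x: "x \<in> \<Sigma>" for n x
  proof (cases "n = 0")
    case True
    then show ?thesis using D[OF x x, of 0] by simp
  next
    case False
    have "(\<integral>p. A p \<partial>\<mu>) \<le> \<beta> + (D - ?m n x) / real n" if \<mu>: "\<mu> \<in> holonomic lam r M" for \<mu>
    proof -
      interpret prob_space \<mu> using holonomic_prob_space[OF \<mu>] .
      have "?m n x - D \<le> (\<integral>p. ?m n (snd p) \<partial>\<mu>)"
        using D[OF x snd_in_sft, of _ n]
        by (intro integral_ge_const holonomic_integrable_lift(2)[OF \<mu>]
            lipschitz_continuous[OF T_iter_zero_lipschitz])
          (auto simp: holonomic_space[OF \<mu>] algebra_simps)
      then have "real n * ((\<integral>p. A p \<partial>\<mu>) - \<beta>) \<le> D - ?m n x"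
        using holonomic_integral_T[OF \<mu>, of n] by linarith
      then show ?thesis using False by (simp add: field_simps)
    qed
    then have "\<beta> \<le> \<beta> + (D - ?m n x) / real n"
      unfolding beta_def[of lam r M A, symmetric] by (subst beta_def) (intro cSUP_least holonomic_nonempty)
    then show ?thesis using False by (simp add: zero_le_divide_iff)
  qed
  ultimately have "normalised_potential r M lam b \<rho> C (A_sup + \<bar>\<beta>\<bar>) (max (K + real L * (A_sup + \<bar>\<beta>\<bar>)) D)"
    by unfold_locales (auto simp: le_max_iff_disj)
  then show ?thesis by blast
qed

definition D :: real where "D = (SOME D. normalised_potential r M lam b \<rho> C (A_sup + \<bar>\<beta>\<bar>) D)"

sublocale normalised_potential r M lam b \<rho> C "A_sup + \<bar>\<beta>\<bar>" D
  unfolding D_def using normalised by (rule someI_ex)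

section \<open>Paths and the Mane potential\<close>

lemma path_to_preorbit:
  assumes "ps \<in> paths lam r M x x' \<epsilon>"
  shows "tau (last ps) \<in> \<Sigma>" "(left_shift ^^ length ps) (tau (last ps)) = x'" "1 \<le> length ps"
    "seq_dist lam (tau (last ps)) x < \<epsilon>" "path_sum lam r M A ps \<le> S (length ps) (tau (last ps))"
proof -
  have ps: "ps \<noteq> []" "set ps \<subseteq> E" "snd (hd ps) = x'"
    "\<forall>j. Suc j < length ps \<longrightarrow> snd (ps ! Suc j) = tau (ps ! j)" "seq_dist lam (tau (last ps)) x < \<epsilon>"
    using assms by (auto simp: paths_def)
  then show "1 \<le> length ps" "seq_dist lam (tau (last ps)) x < \<epsilon>" by (cases ps; simp)+
  show "tau (last ps) \<in> \<Sigma>" using ps(1,2) by (intro tau_in_sft) (meson last_in_set subsetD)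
  have "(left_shift ^^ length ps) (tau (last ps)) = x' \<and> path_sum lam r M A ps \<le> S (length ps) (tau (last ps))"
    using ps(1-4)
  proof (induction ps rule: rev_induct)
    case (snoc p ps)
    have p: "A p - \<beta> \<le> b (tau p)" using snoc.prems(2) by (intro A_le_b) simp
    show ?case
    proof (cases "ps = []")
      case True
      then show ?thesis using snoc.prems p by (simp add: path_sum_def birkhoff_sum_def)
    next
      case False
      have steps: "\<forall>j. Suc j < length ps \<longrightarrow> snd (ps ! Suc j) = tau (ps ! j)"
      proof (intro allI impI)
        fix j assume "Suc j < length ps"
        then show "snd (ps ! Suc j) = tau (ps ! j)" using snoc.prems(4)[rule_format, of j] by (simp add: nth_append)
      qed
      have IH: "(left_shift ^^ length ps) (tau (last ps)) = x'"
          "path_sum lam r M A ps \<le> S (length ps) (tau (last ps))"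
        using snoc.IH[OF False _ _ steps] snoc.prems False by auto
      have "snd p = tau (last ps)"
        using snoc.prems(4)[rule_format, of "length ps - 1"] False
        by (simp add: nth_append last_conv_nth)
      moreover have "path_sum lam r M A (ps @ [p]) = path_sum lam r M A ps + (A p - \<beta>)"
        by (simp add: path_sum_def nth_append)
      ultimately show ?thesis using IH p by (simp add: birkhoff_sum_Suc_shift funpow_swap1)
    qed
  qed simp
  then show "(left_shift ^^ length ps) (tau (last ps)) = x'"
    "path_sum lam r M A ps \<le> S (length ps) (tau (last ps))" by auto
qed

lemma preorbit_to_path:
  assumes z: "z \<in> \<Sigma>" "(left_shift ^^ k) z = x'" "1 \<le> k" "seq_dist lam z x < \<epsilon>"
  obtains ps where "ps \<in> paths lam r M x x' \<epsilon>" "path_sum lam r M A ps = S k z"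
proof -
  define w where "w j = (left_shift ^^ (k - Suc j)) z" for j
  define ps where "ps = map (\<lambda>j. (Y (w j), left_shift (w j))) [0..<k]"
  have w: "w j \<in> \<Sigma>" for j using z(1) by (simp add: w_def)
  have tau_w: "tau (Y (w j), left_shift (w j)) = w j" for j using Y_0[OF w] by (intro tau_eq)
  have len: "length ps = k" and ne: "ps \<noteq> []" using z(3) by (auto simp: ps_def)
  have nth: "ps ! j = (Y (w j), left_shift (w j))" if "j < k" for j using that by (simp add: ps_def)
  have "left_shift (w 0) = x'" using z(2,3) by (cases k) (auto simp: w_def)
  then have "snd (hd ps) = x'" using nth[of 0] z(3) ne by (simp add: hd_conv_nth)
  moreover have "left_shift (w (Suc j)) = w j" if "Suc j < k" for j
  proof -
    have "k - Suc j = Suc (k - Suc (Suc j))" using that by simp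
    then show ?thesis by (simp add: w_def)
  qed
  then have "\<forall>j. Suc j < length ps \<longrightarrow> snd (ps ! Suc j) = tau (ps ! j)" using nth len tau_w by simp
  moreover have "w (k - 1) = z" using z(3) by (simp add: w_def)
  then have "tau (last ps) = z"
    using ne nth[of "k - 1"] z(3) tau_w[of "k - 1"] by (simp add: last_conv_nth len)
  moreover have "set ps \<subseteq> E" using Y_in[OF w] by (auto simp: ps_def)
  ultimately have "ps \<in> paths lam r M x x' \<epsilon>" using ne z(4) by (simp add: paths_def)
  moreover have "path_sum lam r M A ps = (\<Sum>j<k. b (w j))"
    unfolding path_sum_def len b_def using nth by (intro sum.cong) auto
  then have "path_sum lam r M A ps = S k z"
    unfolding birkhoff_sum_def w_def
    using sum.nat_diff_reindex[of "\<lambda>j. b ((left_shift ^^ j) z)" k] by simp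
  ultimately show ?thesis using that by blast
qed

lemma agree_lt_seq_dist:
  assumes "0 < \<epsilon>"
  obtains n where "\<And>x y. agree n x y \<Longrightarrow> seq_dist lam x y < \<epsilon>"
proof -
  obtain n where "lam ^ n < \<epsilon>" using real_arch_pow_inv[OF assms lam(2)] by blast
  then show ?thesis using that agree_le_seq_dist[OF lam] by (meson le_less_trans)
qed

text \<open>
  A path is only bounded above by the Birkhoff sum at its end. In the other direction, a calibrated
  function \<open>u\<close> bounds the sum over a return by \<open>u z - u x\<close>, which is small. Conversely, an optimal
  path has exactly the Birkhoff sum as its weight.
\<close>

lemma nonwandering_eq: "nonwandering lam r M A = \<Omega>"
proof (intro set_eqI iffI)
  fix x assume "x \<in> nonwandering lam r M A"
  then have x: "x \<in> \<Sigma>" "\<And>\<epsilon>. 0 < \<epsilon> \<Longrightarrow> \<exists>ps\<in>paths lam r M x x \<epsilon>. \<bar>path_sum lam r M A ps\<bar> < \<epsilon>"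
    by (auto simp: nonwandering_def)
  obtain u where u: "calibrated u" "lipschitz K u" using calibrated_exists .
  have "\<exists>k\<ge>1. \<exists>z\<in>\<Sigma>. (left_shift ^^ k) z = x \<and> agree n z x \<and> \<bar>S k z\<bar> < \<epsilon>" if \<epsilon>: "0 < \<epsilon>" for \<epsilon> n
  proof -
    obtain m where m: "1 \<le> m" "n \<le> m" "K * \<rho> ^ m < \<epsilon>" using geometric_small[OF \<rho> \<epsilon>] by blast
    obtain ps where ps: "ps \<in> paths lam r M x x (min \<epsilon> (lam ^ m))" "\<bar>path_sum lam r M A ps\<bar> < min \<epsilon> (lam ^ m)"
      using x(2)[of "min \<epsilon> (lam ^ m)"] \<epsilon> lam by auto
    note z = path_to_preorbit[OF ps(1)]
    let ?z = "tau (last ps)" and ?k = "length ps"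
    have ag: "agree m ?z x" using z(4) agree_le_seq_dist[OF lam, of ?z x m] by simp
    have "S ?k ?z \<le> u ?z - u x"
      using subaction_path[OF calibrated_subaction[OF u(1)] z(1), of ?k] z(2) by simp
    then have "S ?k ?z < \<epsilon>" using lipschitzD[OF u(2) z(1) x(1) ag m(1)] m(3) by linarith
    moreover have "- \<epsilon> < S ?k ?z" using z(5) ps(2) by linarith
    moreover have "agree n ?z x" using ag m(2) by (rule agree_mono)
    ultimately show ?thesis using z(1-3) by (intro exI[of _ ?k]) auto
  qed
  then show "x \<in> \<Omega>" using x(1) unfolding \<Omega>_def by blast
next
  fix x assume x: "x \<in> \<Omega>"
  have "\<exists>ps\<in>paths lam r M x x \<epsilon>. \<bar>path_sum lam r M A ps\<bar> < \<epsilon>" if \<epsilon>: "0 < \<epsilon>" for \<epsilon>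
  proof -
    obtain n where n: "\<And>x y. agree n x y \<Longrightarrow> seq_dist lam x y < \<epsilon>" using agree_lt_seq_dist[OF \<epsilon>] by blast
    obtain k z where z: "1 \<le> k" "z \<in> \<Sigma>" "(left_shift ^^ k) z = x" "agree n z x" "\<bar>S k z\<bar> < \<epsilon>"
      using \<Omega>_return[OF x \<epsilon>] by blast
    then show ?thesis using preorbit_to_path[OF z(2,3,1) n[OF z(4)]] by metis
  qed
  then show "x \<in> nonwandering lam r M A" using x \<Omega>_subset by (auto simp: nonwandering_def)
qed

text \<open>
  The infimum over paths increases as \<open>\<epsilon>\<close> decreases, so its limit is a supremum.
\<close>

lemma mane_eq: "mane lam r M A x x' = (SUP \<epsilon>\<in>{0<..}. mane_eps lam r M A \<epsilon> x x')"
proof -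
  let ?g = "\<lambda>\<epsilon>. mane_eps lam r M A \<epsilon> x x'"
  have anti: "?g e' \<le> ?g e" if "e \<le> e'" for e e'
    unfolding mane_eps_def using that by (intro INF_superset_mono) (auto simp: paths_def)
  have "(?g \<longlongrightarrow> (SUP \<epsilon>\<in>{0<..}. ?g \<epsilon>)) (at_right 0)"
  proof (rule order_tendstoI)
    fix a assume "a < (SUP \<epsilon>\<in>{0<..}. ?g \<epsilon>)"
    then obtain e where e: "0 < e" "a < ?g e" by (auto simp: less_SUP_iff)
    then show "eventually (\<lambda>\<epsilon>. a < ?g \<epsilon>) (at_right 0)"
      unfolding eventually_at_right_field using anti by (intro exI[of _ e]) (auto intro: less_le_trans)
  next
    fix a assume a: "(SUP \<epsilon>\<in>{0<..}. ?g \<epsilon>) < a"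
    have "?g \<epsilon> < a" if "0 < \<epsilon>" for \<epsilon>
      using that by (intro le_less_trans[OF SUP_upper a]) simp
    then show "eventually (\<lambda>\<epsilon>. ?g \<epsilon> < a) (at_right 0)"
      unfolding eventually_at_right_field by (intro exI[of _ 1]) auto
  qed
  then show ?thesis unfolding mane_def by (intro tendsto_Lim) auto
qed

lemma mane_le:
  assumes "\<And>\<epsilon> n. 0 < \<epsilon> \<Longrightarrow> \<exists>k\<ge>1. \<exists>z\<in>\<Sigma>. (left_shift ^^ k) z = x' \<and> agree n z x \<and> - S k z < c + \<epsilon>"
  shows "mane lam r M A x x' \<le> ereal c"
  unfolding mane_eq
proof (rule SUP_least)
  fix \<epsilon> :: real assume "\<epsilon> \<in> {0<..}"
  then obtain n where n: "\<And>x y. agree n x y \<Longrightarrow> seq_dist lam x y < \<epsilon>" using agree_lt_seq_dist by auto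
  show "mane_eps lam r M A \<epsilon> x x' \<le> ereal c"
  proof (rule ereal_le_epsilon2)
    fix e :: real assume "0 < e"
    then obtain k z where z: "1 \<le> k" "z \<in> \<Sigma>" "(left_shift ^^ k) z = x'" "agree n z x" "- S k z < c + e"
      using assms by blast
    obtain ps where ps: "ps \<in> paths lam r M x x' \<epsilon>" "path_sum lam r M A ps = S k z"
      using preorbit_to_path[OF z(2,3,1) n[OF z(4)]] .
    show "mane_eps lam r M A \<epsilon> x x' \<le> ereal c + ereal e"
      unfolding mane_eps_def using ps z(5) by (intro INF_lower2[OF ps(1)]) simp
  qed
qed

lemma subaction_le_mane:
  assumes v: "subaction v" "continuous_map (seq_top lam \<Sigma>) euclideanreal v" and x: "x \<in> \<Sigma>"
  shows "ereal (v x' - v x) \<le> mane lam r M A x x'"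
proof (rule ereal_le_epsilon2)
  fix e :: real assume "0 < e"
  then obtain n where n: "\<And>y. y \<in> \<Sigma> \<Longrightarrow> agree n x y \<Longrightarrow> \<bar>v x - v y\<bar> < e"
    using v(2) x unfolding continuous_map_seq_top[OF lam] by blast
  have "ereal (v x' - v x) - ereal e \<le> mane_eps lam r M A (lam ^ n) x x'"
    unfolding mane_eps_def
  proof (rule INF_greatest)
    fix ps assume ps: "ps \<in> paths lam r M x x' (lam ^ n)"
    note z = path_to_preorbit[OF ps]
    let ?z = "tau (last ps)" and ?k = "length ps"
    have "agree n x ?z" using z(4) agree_le_seq_dist[OF lam, of ?z x n] agree_sym by simp
    then have "\<bar>v x - v ?z\<bar> < e" using n z(1) by blast
    moreover have "v x' \<le> v ?z - S ?k ?z" using subaction_path[OF v(1) z(1), of ?k] z(2) by simp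
    ultimately show "ereal (v x' - v x) - ereal e \<le> ereal (- path_sum lam r M A ps)" using z(5) by simp
  qed
  also have "\<dots> \<le> mane lam r M A x x'" unfolding mane_eq using lam by (intro SUP_upper) auto
  finally show "ereal (v x' - v x) \<le> mane lam r M A x x' + ereal e"
    by (cases "mane lam r M A x x'") auto
qed

section \<open>The correspondence\<close>

lemma is_minimum_iff:
  assumes x: "x \<in> \<Sigma>"
  shows "is_minimum ((\<lambda>y. u (tau (y, x)) - A (y, x) + \<beta>) ` sft_fiber r M x) m \<longleftrightarrow> m = T u x"
proof -
  let ?V = "(\<lambda>y. u (tau (y, x)) - A (y, x) + \<beta>) ` sft_fiber r M x"
  obtain z where z: "z \<in> \<Sigma>" "left_shift z = x" "T u x = u z - b z" using T_attained[OF x] .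
  have "Y z \<in> sft_fiber r M x" using Y_in[OF z(1)] z(2) by (auto simp: sft_fiber_def sft_ext_def)
  moreover have "T u x = u (tau (Y z, x)) - A (Y z, x) + \<beta>"
    using z tau_eq[of "Y z" z] Y_0[OF z(1)] by (simp add: b_def)
  ultimately have "T u x \<in> ?V" by blast
  moreover have "T u x \<le> v" if "v \<in> ?V" for v
  proof -
    obtain y where y: "(y, x) \<in> E" "v = u (tau (y, x)) - A (y, x) + \<beta>"
      using \<open>v \<in> ?V\<close> by (auto simp: sft_fiber_def)
    show ?thesis using T_le[OF tau_in_sft[OF y(1)], of u] A_le_b[OF y(1)] y(2) by simp
  qed
  ultimately show ?thesis unfolding is_minimum_def by (meson order_antisym)
qed

lemma calibrated_subactions_eq:
  "calibrated_subactions lam r M A = {u \<in> cont_funs (seq_top lam \<Sigma>). calibrated u}"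
  unfolding calibrated_subactions_def calibrated_def using is_minimum_iff by (auto simp: eq_commute)

lemma admissible_if_admissible_funs:
  assumes "f \<in> admissible_funs lam r M A"
  shows "admissible f"
  unfolding admissible_def
proof (intro ballI allI impI)
  fix x x' c assume x: "x \<in> \<Omega>" "x' \<in> \<Omega>"
    and c: "\<forall>\<epsilon>>0. \<forall>n. \<exists>k\<ge>1. \<exists>z\<in>\<Sigma>. (left_shift ^^ k) z = x' \<and> agree n z x \<and> - S k z < c + \<epsilon>"
  have "ereal (f x' - f x) \<le> mane lam r M A x x'"
    using assms x by (auto simp: admissible_funs_def nonwandering_eq)
  also have "\<dots> \<le> ereal c" using c by (intro mane_le) blast
  finally show "f x' - f x \<le> c" by simp
qed

lemma restrict_admissible_funs:
  assumes u: "calibrated u" "continuous_map (seq_top lam \<Sigma>) euclideanreal u"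
  shows "restrict u \<Omega> \<in> admissible_funs lam r M A"
  using restrict_cont_funs[OF u(2) \<Omega>_subset] subaction_le_mane[OF calibrated_subaction[OF u(1)] u(2)] \<Omega>_subset
  by (auto simp: admissible_funs_def nonwandering_eq)

lemma calibrated_cong:
  assumes "\<And>x. x \<in> \<Sigma> \<Longrightarrow> u x = v x" "calibrated u"
  shows "calibrated v"
  unfolding calibrated_def
proof
  fix x assume x: "x \<in> \<Sigma>"
  have "T v x = T u x" using T_mono[of u v 0 x] T_mono[of v u 0 x] assms(1) x by force
  then show "T v x = v x" using assms x by (simp add: calibrated_def)
qed

text \<open>
  Injectivity compares two calibrated functions at a common point of \<open>\<Omega>\<close>, in both directions;
  surjectivity is the extension of admissible functions.
\<close>

lemma restrict_bij:
  "bij_betw (\<lambda>u. restrict u \<Omega>) (calibrated_subactions lam r M A) (admissible_funs lam r M A)"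
proof (rule bij_betwI')
  fix u v assume uv: "u \<in> calibrated_subactions lam r M A" "v \<in> calibrated_subactions lam r M A"
  have cal: "calibrated w" "continuous_map (seq_top lam \<Sigma>) euclideanreal w" "w \<in> extensional \<Sigma>"
    if "w \<in> calibrated_subactions lam r M A" for w
    using that Metric_space.topspace_mtopology[OF Metric_space_seq_dist[OF lam]]
    by (auto simp: calibrated_subactions_eq cont_funs_def)
  show "restrict u \<Omega> = restrict v \<Omega> \<longleftrightarrow> u = v"
  proof
    assume eq: "restrict u \<Omega> = restrict v \<Omega>"
    then have eq': "u \<zeta> = v \<zeta>" if "\<zeta> \<in> \<Omega>" for \<zeta> using that by (metis restrict_apply')
    have le: "v x \<le> u x" if "x \<in> \<Sigma>" "\<And>\<zeta>. \<zeta> \<in> \<Omega> \<Longrightarrow> u \<zeta> = v \<zeta>"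
      "u \<in> calibrated_subactions lam r M A" "v \<in> calibrated_subactions lam r M A" for x u v
      using compare_at_\<Omega>[OF cal(1,2)[OF that(3)] calibrated_subaction[OF cal(1)[OF that(4)]]
          cal(2)[OF that(4)] that(1)] that(2) by fastforce
    show "u = v"
    proof (rule extensionalityI[OF cal(3)[OF uv(1)] cal(3)[OF uv(2)]])
      fix x assume "x \<in> \<Sigma>"
      then show "u x = v x" using le[of x u v] le[of x v u] eq' uv by fastforce
    qed
  qed simp
next
  fix u assume "u \<in> calibrated_subactions lam r M A"
  then show "restrict u \<Omega> \<in> admissible_funs lam r M A"
    by (intro restrict_admissible_funs) (auto simp: calibrated_subactions_eq cont_funs_def)
next
  fix f assume f: "f \<in> admissible_funs lam r M A"
  obtain u K' where u: "calibrated u" "lipschitz K' u" "\<And>x. x \<in> \<Omega> \<Longrightarrow> u x = f x"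
    using admissible_extends[OF admissible_if_admissible_funs[OF f]] by blast
  have "restrict u \<Sigma> \<in> calibrated_subactions lam r M A"
    unfolding calibrated_subactions_eq
    using restrict_cont_funs[OF lipschitz_continuous[OF u(2)] order_refl]
      calibrated_cong[OF _ u(1), of "restrict u \<Sigma>"] by simp
  moreover have "f \<in> extensional \<Omega>"
    using f Metric_space.topspace_mtopology[OF Metric_space_seq_dist[OF lam]]
    by (auto simp: admissible_funs_def cont_funs_def nonwandering_eq)
  then have "f = restrict (restrict u \<Sigma>) \<Omega>"
    using u(3) \<Omega>_subset by (intro extensionalityI[of _ \<Omega>]) auto
  ultimately show "\<exists>w\<in>calibrated_subactions lam r M A. f = restrict w \<Omega>" by blast
qed

lemma restrict_isometry:
  assumes "u \<in> calibrated_subactions lam r M A" "v \<in> calibrated_subactions lam r M A"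
  shows "sup_norm \<Omega> (\<lambda>x. restrict u \<Omega> x - restrict v \<Omega> x) = sup_norm \<Sigma> (\<lambda>x. u x - v x)"
proof -
  have cal: "calibrated w" "continuous_map (seq_top lam \<Sigma>) euclideanreal w"
    if "w \<in> calibrated_subactions lam r M A" for w
    using that by (auto simp: calibrated_subactions_eq cont_funs_def)
  note u = cal[OF assms(1)] and v = cal[OF assms(2)]
  let ?d = "\<lambda>x. \<bar>u x - v x\<bar>"
  obtain B1 where "\<And>x. x \<in> \<Sigma> \<Longrightarrow> \<bar>u x\<bar> \<le> B1" using continuous_bounded[OF u(2)] by blast
  moreover obtain B2 where "\<And>x. x \<in> \<Sigma> \<Longrightarrow> \<bar>v x\<bar> \<le> B2" using continuous_bounded[OF v(2)] by blast
  ultimately have "?d x \<le> B1 + B2" if "x \<in> \<Sigma>" for x using that by (smt (verit))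
  then have bdd: "bdd_above (?d ` \<Sigma>)" by (intro bdd_aboveI[of _ "B1 + B2"]) auto
  have "(SUP x\<in>\<Omega>. ?d x) = (SUP x\<in>\<Sigma>. ?d x)"
  proof (rule antisym)
    show "(SUP x\<in>\<Omega>. ?d x) \<le> (SUP x\<in>\<Sigma>. ?d x)"
      using \<Omega>_nonempty bdd \<Omega>_subset by (intro cSUP_subset_mono) auto
    show "(SUP x\<in>\<Sigma>. ?d x) \<le> (SUP x\<in>\<Omega>. ?d x)"
    proof (rule cSUP_least[OF nonempty])
      fix x assume x: "x \<in> \<Sigma>"
      obtain \<zeta> where \<zeta>: "\<zeta> \<in> \<Omega>" "v x - u x \<le> v \<zeta> - u \<zeta>"
        using compare_at_\<Omega>[OF u calibrated_subaction[OF v(1)] v(2) x] .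
      obtain \<xi> where \<xi>: "\<xi> \<in> \<Omega>" "u x - v x \<le> u \<xi> - v \<xi>"
        using compare_at_\<Omega>[OF v calibrated_subaction[OF u(1)] u(2) x] .
      have "?d y \<le> (SUP x\<in>\<Omega>. ?d x)" if "y \<in> \<Omega>" for y
        using that bdd_above_mono[OF bdd image_mono[OF \<Omega>_subset]] by (rule cSUP_upper)
      then show "?d x \<le> (SUP x\<in>\<Omega>. ?d x)" using \<zeta> \<xi> by (smt (verit))
    qed
  qed
  then show ?thesis by (simp add: sup_norm_def)
qed

end

theorem theorem15:
  fixes r :: nat
    and M :: "nat \<Rightarrow> nat \<Rightarrow> nat"
    and lam \<theta> :: real
    and A :: "(nat \<Rightarrow> nat) \<times> (nat \<Rightarrow> nat) \<Rightarrow> real"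
  assumes M_01: "\<forall>i\<in>{1..r}. \<forall>j\<in>{1..r}. M i j \<in> {0, 1}"
    and nonempty: "sft r M \<noteq> {}"
    and lam: "0 < lam" "lam < 1"
    and theta: "0 < \<theta>"
    and transitive: "transitive_map (seq_top lam (sft r M)) left_shift"
    and holder: "holder_fun \<theta> (sft_ext r M) (ext_dist lam) A"
  shows "\<exists>\<Phi>. bij_betw \<Phi> (calibrated_subactions lam r M A) (admissible_funs lam r M A) \<and>
    (\<forall>u\<in>calibrated_subactions lam r M A. \<forall>v\<in>calibrated_subactions lam r M A.
      sup_norm (nonwandering lam r M A) (\<lambda>x. \<Phi> u x - \<Phi> v x) =
      sup_norm (sft r M) (\<lambda>x. u x - v x))"
proof -
  obtain C where C: "\<And>p q. p \<in> sft_ext r M \<Longrightarrow> q \<in> sft_ext r M \<Longrightarrow>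
      \<bar>A p - A q\<bar> \<le> C * ext_dist lam p q powr \<theta>"
    using holder unfolding holder_fun_def by blast
  interpret holder_potential r M lam A "lam powr \<theta>" "\<bar>C\<bar>"
  proof
    show "lam powr \<theta> < 1" using powr_less_mono2[of \<theta> lam 1] lam theta by simp
    fix n p q
    assume pq: "p \<in> sft_ext r M" "q \<in> sft_ext r M"
      "agree n (fst p) (fst q)" "agree n (snd p) (snd q)"
    interpret d: Metric_space UNIV "ext_dist lam" by (rule Metric_space_ext_dist[OF lam])
    have "ext_dist lam p q \<le> lam ^ n"
      using pq(3,4) by (simp add: ext_dist_def agree_le_seq_dist[OF lam])
    then have "ext_dist lam p q powr \<theta> \<le> (lam ^ n) powr \<theta>"
      using d.nonneg theta by (intro powr_mono2) auto
    also have "\<dots> = (lam powr \<theta>) ^ n"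
      using lam by (simp add: powr_powr mult.commute flip: powr_realpow)
    finally have "\<bar>C\<bar> * ext_dist lam p q powr \<theta> \<le> \<bar>C\<bar> * (lam powr \<theta>) ^ n"
      by (intro mult_left_mono) auto
    moreover have "C * ext_dist lam p q powr \<theta> \<le> \<bar>C\<bar> * ext_dist lam p q powr \<theta>"
      by (intro mult_right_mono) auto
    ultimately show "\<bar>A p - A q\<bar> \<le> \<bar>C\<bar> * (lam powr \<theta>) ^ n" using C[OF pq(1,2)] by linarith
  qed (use nonempty lam transitive in auto)
  show ?thesis
    using restrict_bij restrict_isometry unfolding nonwandering_eq by blast
qed

end
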